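(* Let $G$ be a countable amenable group, let $(\Gamma,\lambda)\in\mathcal{H}_G$, and let $U_0$ be a fixed fundamental domain of $G\curvearrowright\Gamma$. Then for every Gibbs measure $\mathbb{P}\in\mathcal{M}_{\mathrm{Gibbs}}(\Gamma,\lambda)$, every tempered (right) F\o lner sequence $\{F_n\}_n$ of $G$ and every $G$-invariant $G$-ergodic Borel probability measure $\mathbb{Q}$ on $X(\Gamma)$, $$\lim_{n}\left[-\frac{1}{|F_nU_0|}\log\mathbb{P}([x_{F_nU_0}])\right]=-\int\phi_\lambda\,d\mathbb{Q}+f_G(\Gamma,\lambda)\qquad\text{for }\mathbb{Q}\text{-almost every }x\in X(\Gamma).$$
   Context: A graph $\Gamma=(V,E)$ has a countable vertex set $V$ and a symmetric edge relation $E\subseteq V\times V$; graphs are loopless. $X(\Gamma)\subseteq\{0,1\}^V$ is the set of (indicator functions of) independent sets, with the topology and Borel $\sigma$-algebra inherited from the product topology. For $W\subseteq V$ finite and $x\in X(\Gamma)$, $[x_W]=\{x'\in X(\Gamma):x'|_W=x|_W\}$. An activity function is a map $\lambda:V\to\mathbb{R}_{>0}$; $(\Gamma,\lambda)$ is a hardcore model. For finite $U\subseteq V$, $Z_\Gamma(U,\lambda)=\sum_x\prod_{v\in U}\lambda(v)^{x(v)}$, summing over $x\in X(\Gamma)$ with $x=0$ off $U$. $\mathcal{H}_G$ is the set of hardcore models $(\Gamma,\lambda)$ such that $\Gamma$ is countable and locally finite, $G$ is (isomorphic to) a subgroup of $\mathrm{Aut}(\Gamma)$ acting (from the left, $(g,v)\mapsto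 gv=g(v)$) freely (trivial vertex stabilizers) and almost transitively (finitely many orbits) on $V$, and $\lambda$ is $G$-invariant, $\lambda(gv)=\lambda(v)$. $\Gamma/G$ is the set of $G$-orbits. A fundamental domain $U_0\subseteq V$ is a set containing exactly one vertex of each orbit; it is finite with $|U_0|=|\Gamma/G|$. For $F\subseteq G$, $FU_0=\{gv:g\in F,v\in U_0\}$. $G$ acts on $X(\Gamma)$ by $g\cdot x=x\circ g^{-1}$; invariance and ergodicity of measures refer to this action. The free energy is $f_G(\Gamma,\lambda)=\inf_{F}\frac{\log Z_\Gamma(FU_0,\lambda)}{|FU_0|}$, the infimum over finite nonempty $F\subseteq G$; it does not depend on $U_0$. The function $\phi_\lambda:X(\Gamma)\to\mathbb{R}$ is $\phi_\lambda(x)=\frac{1}{|\Gamma/G|}\sum_{v\in U_0}x(v)\log\lambda(v)$. Gibbs measures: for finite nonempty $U\subseteq V$ and $y\in X(\Gamma)$, $\pi_U^y$ is the probability measure on $\{x\in X(\Gamma):x=y\text{ off }U\}$ with $\pi_U^y(x)$ proportional to $\prod_{v\in U}\lambda(v)^{x(v)}$. A Borel probability measure $\mathbb{P}$ on $X(\Gamma)$ is a Gibbs measure for $(\Gamma,\lambda)$ if for all finite $U\subseteq V$, $U'\subseteq U$ and $x\in X(\Gamma)$, $\mathbb{P}([x_{U'}]\mid\mathcal{B}_{U^c})(y)=\pi_U^y([x_{U'}])$ for $\mathbb{P}$-a.e. $y$, where $\mathcal{B}_{U^c}$ is the $\sigma$-algebra generated by the coordinates outside $U$. $\mathcal{M}_{\mathrm{Gibbs}}(\Gamma,\lambda)$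 is the set of these. A right F\o lner sequence is a sequence of finite nonempty $F_n\subseteq G$ with $|F_ng\triangle F_n|/|F_n|\to0$ for all $g\in G$. It is called tempered if there is $C>0$ with $\left|\bigcup_{k<n}F_kF_n^{-1}\right|\le C|F_n|$ for all $n$ (i.e. the left F\o lner sequence $\{F_n^{-1}\}_n$ is tempered in Lindenstrauss's sense). *)

theory Defs
  imports "HOL-Probability.Probability" "HOL-Algebra.Group_Action"
begin

subsection \<open>Hardcore models\<close>

text \<open>
  Configurations are \<open>{0,1}\<close>-valued functions on the vertex set \<open>V\<close>; as members of the dependent
  function space they take the value \<open>undefined\<close> off \<open>V\<close>, so that they correspond bijectively to
  elements of \<open>{0,1}\<^sup>V\<close>.
\<close>

definition indep_configs :: "'v set \<Rightarrow> ('v \<times> 'v) set \<Rightarrow> ('v \<Rightarrow> nat) set" where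
  "indep_configs V E =
     {x \<in> V \<rightarrow>\<^sub>E {0, 1}. \<forall>(u, v) \<in> E. \<not> (x u = 1 \<and> x v = 1)}"

definition config_topology :: "'v set \<Rightarrow> ('v \<times> 'v) set \<Rightarrow> ('v \<Rightarrow> nat) topology" where
  "config_topology V E =
     subtopology (product_topology (\<lambda>_. discrete_topology {0, 1}) V) (indep_configs V E)"

definition config_borel :: "'v set \<Rightarrow> ('v \<times> 'v) set \<Rightarrow> ('v \<Rightarrow> nat) measure" where
  "config_borel V E = sigma (indep_configs V E) {U. openin (config_topology V E) U}"

definition config_prob :: "'v set \<Rightarrow> ('v \<times> 'v) set \<Rightarrow> ('v \<Rightarrow> nat) measure \<Rightarrow> bool" where
  "config_prob V E P \<longleftrightarrow> prob_space P \<and> sets P = sets (config_borel V E)"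

definition cylinder :: "'v set \<Rightarrow> ('v \<times> 'v) set \<Rightarrow> 'v set \<Rightarrow> ('v \<Rightarrow> nat) \<Rightarrow> ('v \<Rightarrow> nat) set" where
  "cylinder V E W x = {x' \<in> indep_configs V E. \<forall>v\<in>W. x' v = x v}"

definition partition_function ::
    "'v set \<Rightarrow> ('v \<times> 'v) set \<Rightarrow> ('v \<Rightarrow> real) \<Rightarrow> 'v set \<Rightarrow> real" where
  "partition_function V E lam U =
     (\<Sum>x \<in> {x \<in> indep_configs V E. \<forall>v \<in> V - U. x v = 0}. \<Prod>v\<in>U. lam v ^ x v)"

locale hardcore_model =
  fixes V :: "'v set" and E :: "('v \<times> 'v) set" and lam :: "'v \<Rightarrow> real"
  assumes countable_V: "countable V"
    and E_subset: "E \<subseteq> V \<times> V"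
    and sym_E: "sym E"
    and loopless: "irrefl E"
    and lam_pos: "v \<in> V \<Longrightarrow> lam v > 0"


subsection \<open>The class of hardcore models with an action of \<open>G\<close>\<close>

text \<open>
  The embedding of \<open>G\<close> into the automorphism group of the graph is the injective homomorphism
  \<open>act\<close> from \<open>G\<close> to the bijections of \<open>V\<close>; \<open>act g v\<close> is \<open>gv\<close>.
\<close>

locale hardcore_G = hardcore_model V E lam + faithful_action G V act
  for G :: "('g, 'm) monoid_scheme" (structure)
    and V :: "'v set" and E :: "('v \<times> 'v) set" and lam :: "'v \<Rightarrow> real"
    and act :: "'g \<Rightarrow> 'v \<Rightarrow> 'v" +
  assumes locally_finite: "v \<in> V \<Longrightarrow> finite (E `` {v})"
    and automorphism: "\<lbrakk>g \<in> carrier G; u \<in> V; v \<in> V\<rbrakk> \<Longrightarrow> (act g u, act g v) \<in> E \<longleftrightarrow> (u, v) \<in> E"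
    and free: "v \<in> V \<Longrightarrow> stabilizer G act v = {\<one>}"
    and almost_transitive: "finite (orbits G V act)"
    and lam_invariant: "\<lbrakk>g \<in> carrier G; v \<in> V\<rbrakk> \<Longrightarrow> lam (act g v) = lam v"

definition fundamental_domain ::
    "('g, 'm) monoid_scheme \<Rightarrow> 'v set \<Rightarrow> ('g \<Rightarrow> 'v \<Rightarrow> 'v) \<Rightarrow> 'v set \<Rightarrow> bool" where
  "fundamental_domain G V act U\<^sub>0 \<longleftrightarrow>
     U\<^sub>0 \<subseteq> V \<and> (\<forall>B \<in> orbits G V act. \<exists>!v. v \<in> U\<^sub>0 \<and> v \<in> B)"

definition translates :: "('g \<Rightarrow> 'v \<Rightarrow> 'v) \<Rightarrow> 'g set \<Rightarrow> 'v set \<Rightarrow> 'v set" where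
  "translates act F U = {act g v | g v. g \<in> F \<and> v \<in> U}"

definition free_energy ::
    "('g, 'm) monoid_scheme \<Rightarrow> 'v set \<Rightarrow> ('v \<times> 'v) set \<Rightarrow> ('v \<Rightarrow> real) \<Rightarrow>
     ('g \<Rightarrow> 'v \<Rightarrow> 'v) \<Rightarrow> 'v set \<Rightarrow> real" where
  "free_energy G V E lam act U\<^sub>0 =
     (INF F \<in> {F. F \<subseteq> carrier G \<and> finite F \<and> F \<noteq> {}}.
        ln (partition_function V E lam (translates act F U\<^sub>0)) / real (card (translates act F U\<^sub>0)))"

definition phi ::
    "('g, 'm) monoid_scheme \<Rightarrow> 'v set \<Rightarrow> ('v \<Rightarrow> real) \<Rightarrow>
     ('g \<Rightarrow> 'v \<Rightarrow> 'v) \<Rightarrow> 'v set \<Rightarrow> ('v \<Rightarrow> nat) \<Rightarrow> real" where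
  "phi G V lam act U\<^sub>0 x =
     1 / real (card (orbits G V act)) * (\<Sum>v\<in>U\<^sub>0. real (x v) * ln (lam v))"


subsection \<open>Gibbs measures\<close>

definition agreeing_off ::
    "'v set \<Rightarrow> ('v \<times> 'v) set \<Rightarrow> 'v set \<Rightarrow> ('v \<Rightarrow> nat) \<Rightarrow> ('v \<Rightarrow> nat) set" where
  "agreeing_off V E U y = {x \<in> indep_configs V E. \<forall>v \<in> V - U. x v = y v}"

text \<open>
  The function below is a probability mass function if \<open>U \<subseteq> V\<close> is finite, \<open>lam\<close> is positive and
  \<open>y\<close> is a configuration; see \<open>pmf_gibbs_spec\<close>.
\<close>

definition gibbs_spec ::
    "'v set \<Rightarrow> ('v \<times> 'v) set \<Rightarrow> ('v \<Rightarrow> real) \<Rightarrow> 'v set \<Rightarrow> ('v \<Rightarrow> nat) \<Rightarrow> ('v \<Rightarrow> nat) pmf" where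
  "gibbs_spec V E lam U y =
     embed_pmf (\<lambda>x. if x \<in> agreeing_off V E U y
       then (\<Prod>v\<in>U. lam v ^ x v) / (\<Sum>x' \<in> agreeing_off V E U y. \<Prod>v\<in>U. lam v ^ x' v)
       else 0)"

definition coord_algebra ::
    "'v set \<Rightarrow> ('v \<times> 'v) set \<Rightarrow> 'v set \<Rightarrow> ('v \<Rightarrow> nat) measure" where
  "coord_algebra V E S =
     sigma (indep_configs V E) {{x \<in> indep_configs V E. x v \<in> A} | v A. v \<in> S}"

definition gibbs_measure ::
    "'v set \<Rightarrow> ('v \<times> 'v) set \<Rightarrow> ('v \<Rightarrow> real) \<Rightarrow> ('v \<Rightarrow> nat) measure \<Rightarrow> bool" where
  "gibbs_measure V E lam P \<longleftrightarrow> config_prob V E P \<and>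
     (\<forall>U U' x. U \<subseteq> V \<and> finite U \<and> U' \<subseteq> U \<and> x \<in> indep_configs V E \<longrightarrow>
        (AE y in P. real_cond_exp P (coord_algebra V E (V - U))
                      (indicator (cylinder V E U' x)) y
                    = measure_pmf.prob (gibbs_spec V E lam U y) (cylinder V E U' x)))"


subsection \<open>Invariance and ergodicity\<close>

definition shift ::
    "('g, 'm) monoid_scheme \<Rightarrow> 'v set \<Rightarrow> ('g \<Rightarrow> 'v \<Rightarrow> 'v) \<Rightarrow> 'g \<Rightarrow> ('v \<Rightarrow> nat) \<Rightarrow> ('v \<Rightarrow> nat)" where
  "shift G V act g x = (\<lambda>v\<in>V. x (act (inv\<^bsub>G\<^esub> g) v))"

definition G_invariant ::
    "('g, 'm) monoid_scheme \<Rightarrow> 'v set \<Rightarrow> ('g \<Rightarrow> 'v \<Rightarrow> 'v) \<Rightarrow> ('v \<Rightarrow> nat) measure \<Rightarrow> bool" where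
  "G_invariant G V act Q \<longleftrightarrow>
     (\<forall>g \<in> carrier G. \<forall>A \<in> sets Q.
        emeasure Q (shift G V act g -` A \<inter> space Q) = emeasure Q A)"

definition G_ergodic ::
    "('g, 'm) monoid_scheme \<Rightarrow> 'v set \<Rightarrow> ('g \<Rightarrow> 'v \<Rightarrow> 'v) \<Rightarrow> ('v \<Rightarrow> nat) measure \<Rightarrow> bool" where
  "G_ergodic G V act Q \<longleftrightarrow>
     (\<forall>A \<in> sets Q. (\<forall>g \<in> carrier G. shift G V act g -` A \<inter> space Q = A) \<longrightarrow>
        emeasure Q A = 0 \<or> emeasure Q A = 1)"


subsection \<open>Amenability\<close>

definition right_Folner :: "('g, 'm) monoid_scheme \<Rightarrow> (nat \<Rightarrow> 'g set) \<Rightarrow> bool" where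
  "right_Folner G F \<longleftrightarrow>
     (\<forall>n. F n \<subseteq> carrier G \<and> finite (F n) \<and> F n \<noteq> {}) \<and>
     (\<forall>g \<in> carrier G.
        (\<lambda>n. real (card (sym_diff (F n #>\<^bsub>G\<^esub> g) (F n))) / real (card (F n))) \<longlonglongrightarrow> 0)"

definition tempered :: "('g, 'm) monoid_scheme \<Rightarrow> (nat \<Rightarrow> 'g set) \<Rightarrow> bool" where
  "tempered G F \<longleftrightarrow>
     (\<exists>C>0. \<forall>n. real (card (\<Union>k<n. F k <#>\<^bsub>G\<^esub> set_inv\<^bsub>G\<^esub> (F n))) \<le> C * real (card (F n)))"

text \<open>Amenability of countable groups, in terms of F\o lner sequences.\<close>

definition amenable :: "('g, 'm) monoid_scheme \<Rightarrow> bool" where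
  "amenable G \<longleftrightarrow> (\<exists>F. right_Folner G F)"


subsection \<open>Well-definedness facts\<close>

lemma topspace_config_topology: "topspace (config_topology V E) = indep_configs V E"
  by (auto simp: config_topology_def indep_configs_def)

lemma space_config_borel: "space (config_borel V E) = indep_configs V E"
  unfolding config_borel_def
  by (rule space_measure_of) (use openin_subset[of "config_topology V E"] in \<open>auto simp: topspace_config_topology\<close>)

lemma sets_config_borel:
  "sets (config_borel V E) = sigma_sets (indep_configs V E) {U. openin (config_topology V E) U}"
  unfolding config_borel_def
  by (rule sets_measure_of) (use openin_subset[of "config_topology V E"] in \<open>auto simp: topspace_config_topology\<close>)

lemma config_prob_space: "config_prob V E P \<Longrightarrow> space P = indep_configs V E"
  by (metis config_prob_def sets_eq_imp_space_eq space_config_borel)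

lemma coord_set_open:
  assumes "v \<in> V"
  shows "openin (config_topology V E) {x \<in> indep_configs V E. x v \<in> A}"
proof -
  let ?T = "product_topology (\<lambda>_. discrete_topology {0, 1 :: nat}) V"
  have c: "continuous_map ?T (discrete_topology {0, 1}) (\<lambda>x. x v)"
    by (rule continuous_map_product_projection[OF assms])
  have "openin ?T {x \<in> topspace ?T. x v \<in> A \<inter> {0, 1}}"
    by (rule openin_continuous_map_preimage[OF c]) simp
  then have "openin (config_topology V E) ({x \<in> topspace ?T. x v \<in> A \<inter> {0, 1}} \<inter> indep_configs V E)"
    unfolding config_topology_def openin_subtopology by blast
  moreover have "{x \<in> topspace ?T. x v \<in> A \<inter> {0, 1}} \<inter> indep_configs V E
      = {x \<in> indep_configs V E. x v \<in> A}"
    using assms by (fastforce simp: indep_configs_def PiE_def Pi_def)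
  ultimately show ?thesis by simp
qed

lemma subalgebra_coord_algebra:
  assumes "config_prob V E P" "S \<subseteq> V"
  shows "subalgebra P (coord_algebra V E S)"
proof -
  let ?G = "{{x \<in> indep_configs V E. x v \<in> A} | v A. v \<in> S}"
  have sp: "?G \<subseteq> Pow (indep_configs V E)" by auto
  have "?G \<subseteq> sigma_sets (indep_configs V E) {U. openin (config_topology V E) U}"
    using assms(2) coord_set_open[of _ V E] by auto
  then have "sigma_sets (indep_configs V E) ?G \<subseteq> sets P"
    using assms(1) unfolding config_prob_def sets_config_borel
    by (simp add: sigma_sets_mono)
  then show ?thesis
    unfolding subalgebra_def coord_algebra_def
    using config_prob_space[OF assms(1)] sp by (simp add: sets_measure_of space_measure_of)
qed

lemma cylinder_in_sets:
  assumes "config_prob V E P" "finite W" "W \<subseteq> V"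
  shows "cylinder V E W x \<in> sets P"
proof -
  have "cylinder V E W x =
      (\<Inter>v\<in>W. {x' \<in> indep_configs V E. x' v \<in> {x v}}) \<inter> indep_configs V E"
    by (auto simp: cylinder_def)
  also have "openin (config_topology V E) \<dots>"
    unfolding topspace_config_topology[of V E, symmetric]
    by (rule openin_INT[OF assms(2)])
      (use assms(3) coord_set_open[of _ V E, folded topspace_config_topology] in blast)
  finally show ?thesis
    using assms(1) by (auto simp: config_prob_def sets_config_borel)
qed

lemma finite_agreeing_off:
  assumes "finite U"
  shows "finite (agreeing_off V E U y)"
proof (rule finite_imageD)
  let ?r = "\<lambda>x :: 'a \<Rightarrow> nat. restrict x (U \<inter> V)"
  have "?r ` agreeing_off V E U y \<subseteq> (U \<inter> V) \<rightarrow>\<^sub>E {0, 1}"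
    by (auto simp: agreeing_off_def indep_configs_def PiE_def Pi_def)
  then show "finite (?r ` agreeing_off V E U y)"
    by (rule finite_subset) (use assms in \<open>auto intro: finite_PiE\<close>)
  show "inj_on ?r (agreeing_off V E U y)"
  proof (rule inj_onI, rule ext)
    fix a b v
    assume a: "a \<in> agreeing_off V E U y" and b: "b \<in> agreeing_off V E U y" and eq: "?r a = ?r b"
    consider "v \<in> U \<inter> V" | "v \<in> V - U" | "v \<notin> V" by blast
    then show "a v = b v"
    proof cases
      case 1
      then show ?thesis using fun_cong[OF eq, of v] by simp
    next
      case 2
      then show ?thesis using a b by (simp add: agreeing_off_def)
    next
      case 3
      then show ?thesis using a b
        by (auto simp: agreeing_off_def indep_configs_def PiE_def extensional_def)
    qed
  qed
qed

lemma pmf_gibbs_spec: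
  assumes "U \<subseteq> V" "finite U" "\<And>v. v \<in> V \<Longrightarrow> lam v > 0" "y \<in> indep_configs V E"
  shows "pmf (gibbs_spec V E lam U y) x =
    (if x \<in> agreeing_off V E U y
     then (\<Prod>v\<in>U. lam v ^ x v) / (\<Sum>x' \<in> agreeing_off V E U y. \<Prod>v\<in>U. lam v ^ x' v)
     else 0)"
proof -
  let ?C = "agreeing_off V E U y"
  let ?w = "\<lambda>x. \<Prod>v\<in>U. lam v ^ x v"
  let ?f = "\<lambda>x. if x \<in> ?C then ?w x / sum ?w ?C else 0"
  have fin: "finite ?C" by (rule finite_agreeing_off[OF assms(2)])
  have w: "?w x > 0" for x using assms(1,3) by (intro prod_pos) auto
  have "y \<in> ?C" using assms(4) by (simp add: agreeing_off_def)
  then have s: "sum ?w ?C > 0" using fin w by (intro sum_pos) auto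
  have nn: "?f z \<ge> 0" for z using w[of z] s by (simp add: less_imp_le)
  have "(\<integral>\<^sup>+ x. ennreal (?f x) \<partial>count_space UNIV) = (\<Sum>x\<in>?C. ennreal (?f x))"
    by (rule nn_integral_count_space'[OF fin]) auto
  also have "\<dots> = ennreal (\<Sum>x\<in>?C. ?f x)" by (rule sum_ennreal) (rule nn)
  also have "(\<Sum>x\<in>?C. ?f x) = sum ?w ?C / sum ?w ?C"
    by (subst sum_divide_distrib) (rule sum.cong, auto)
  also have "\<dots> = 1" using s by simp
  finally show ?thesis
    unfolding gibbs_spec_def using nn by (subst pmf_embed_pmf) auto
qed

end

theory Submission
  imports Defs
begin

text \<open>
Write \<open>Z(U)\<close> for the partition function of a finite set \<open>U\<close> of vertices and \<open>U\<^sub>n = F\<^sub>n U\<^sub>0\<close>. The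
theorem splits into three statements.

First, for a Gibbs measure the cylinder probability is explicit up to a boundary term. If \<open>D\<close> is disjoint from
\<open>U\<close> and \<open>U \<union> D\<close> contains all neighbours of \<open>U\<close>, then conditioning on the outside of \<open>U \<union> D\<close> gives
\<open>|ln P[x\<^sub>U] - (\<Sum>v\<in>U. x(v) ln \<lambda>(v) - ln Z(U))| \<le> ln Z(D)\<close> for every configuration \<open>x\<close>
(\<open>ln_gibbs_cylinder\<close>): putting zeros on \<open>D\<close> decouples \<open>U\<close> from the outside, and forgetting what happens on \<open>D\<close>
costs a factor of at most \<open>Z(D)\<close>. For \<open>U = U\<^sub>n\<close> the set \<open>D\<close> consists of the translates of \<open>U\<^sub>0\<close> by
\<open>F\<^sub>n K - F\<^sub>n\<close>, for a fixed finite \<open>K\<close>, so that \<open>ln Z(D) = o(|F\<^sub>n|)\<close>.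

Secondly, \<open>ln Z(U\<^sub>n) / |U\<^sub>n|\<close> tends to its infimum over all finite \<open>F\<close> (\<open>free_energy_limit\<close>). This rests on
a Shearer type inequality: if every point of \<open>U\<close> is covered exactly \<open>k\<close> times by the sets \<open>K\<^sub>i\<close>, then
\<open>Z(U)\<^sup>k \<le> \<Prod>i. Z(U \<inter> K\<^sub>i)\<close> (\<open>partition_function_Shearer\<close>), which follows from Finner's inequality. It is applied
to the cover of \<open>F\<^sub>n U\<^sub>0\<close> by the translates \<open>g K U\<^sub>0\<close> with \<open>g \<in> F\<^sub>n K\<^sup>-\<^sup>1\<close>, each point being covered \<open>|K|\<close> times.

Thirdly, \<open>(\<Sum>v\<in>U\<^sub>n. x(v) ln \<lambda>(v)) / |U\<^sub>n|\<close> is the average over \<open>F\<^sub>n\<close> of \<open>\<phi>\<^sub>\<lambda>\<close> along the orbit of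
\<open>x\<close>, and converges \<open>Q\<close>-almost everywhere to the integral of \<open>\<phi>\<^sub>\<lambda>\<close> by Lindenstrauss' ergodic theorem
(\<open>pointwise_ergodic\<close>). As usual this is a maximal inequality together with the mean ergodic theorem.
The maximal inequality is transferred from a deterministic covering lemma on the group (\<open>tempered_covering\<close>),
in which translates are selected greedily according to the mass that they carry. The mean ergodic theorem is
proved by looking for an element of nearly minimal norm in a convex set of averages of the function.
\<close>

section \<open>Covering by translates of tempered F\o lner sets\<close>

context group
begin

lemma sum_left_translate:
  assumes "A \<subseteq> carrier G" "g \<in> carrier G"
  shows "(\<Sum>h\<in>(\<otimes>) g ` A. w h) = (\<Sum>a\<in>A. w (g \<otimes> a))"
proof -
  have "(\<otimes>) g ` A = (\<lambda>a. g \<otimes> a) ` A" by (auto simp: image_iff)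
  moreover have "inj_on (\<lambda>a. g \<otimes> a) A" using assms by (intro inj_onI) (auto simp: subset_iff)
  ultimately show ?thesis by (simp add: sum.reindex)
qed

text \<open>
The F\o lner condition, stated for single elements, extends to finite sets \<open>K\<close> because \<open>F\<^sub>n K - F\<^sub>n\<close> is contained
in the union of the finitely many sets \<open>F\<^sub>n k - F\<^sub>n\<close>.
\<close>

lemma right_Folner_almost_invariant:
  assumes F: "right_Folner G F" and K: "finite K" "K \<subseteq> carrier G"
  shows "(\<lambda>n. real (card ((F n <#> K) - F n)) / real (card (F n))) \<longlonglongrightarrow> 0"
proof (rule tendsto_sandwich[OF _ _ tendsto_const])
  have F': "F n \<subseteq> carrier G" "finite (F n)" "F n \<noteq> {}" for n
    using F by (auto simp: right_Folner_def)
  let ?s = "\<lambda>n k. sym_diff (F n #> k) (F n)"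
  show "(\<lambda>n. \<Sum>k\<in>K. real (card (?s n k)) / real (card (F n))) \<longlonglongrightarrow> 0"
    by (intro tendsto_null_sum) (use F K in \<open>auto simp: right_Folner_def\<close>)
  have "real (card ((F n <#> K) - F n)) / real (card (F n))
      \<le> (\<Sum>k\<in>K. real (card (?s n k)) / real (card (F n)))" for n
  proof -
    have fin: "finite (?s n k)" for k using F'(2)[of n] by (simp add: r_coset_def)
    have "(F n <#> K) - F n \<subseteq> (\<Union>k\<in>K. ?s n k)" by (auto simp: set_mult_def r_coset_def)
    then have "card ((F n <#> K) - F n) \<le> card (\<Union>k\<in>K. ?s n k)"
      using K fin by (intro card_mono) auto
    also have "\<dots> \<le> (\<Sum>k\<in>K. card (?s n k))" by (rule card_UN_le[OF K(1)])
    finally have "real (card ((F n <#> K) - F n)) \<le> (\<Sum>k\<in>K. real (card (?s n k)))"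
      by (metis of_nat_mono of_nat_sum)
    then show ?thesis by (simp add: sum_divide_distrib[symmetric] divide_right_mono)
  qed
  then show "\<forall>\<^sub>F n in sequentially. real (card ((F n <#> K) - F n)) / real (card (F n))
      \<le> (\<Sum>k\<in>K. real (card (?s n k)) / real (card (F n)))" by simp
qed auto

lemma right_Folner_growth:
  assumes F: "right_Folner G F" and K: "finite K" "K \<subseteq> carrier G"
  obtains r where "r \<longlonglongrightarrow> 1" "\<And>n. real (card (F n <#> K)) \<le> r n * real (card (F n))"
proof
  let ?r = "\<lambda>n. 1 + real (card ((F n <#> K) - F n)) / real (card (F n))"
  show "?r \<longlonglongrightarrow> 1"
    using tendsto_add[OF tendsto_const[of 1] right_Folner_almost_invariant[OF assms]] by simp
  fix n
  have F': "finite (F n)" "F n \<noteq> {}" using F by (auto simp: right_Folner_def)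
  then have fin: "finite (F n <#> K)" using K by (auto simp: set_mult_def)
  have "card (F n <#> K) \<le> card (F n \<union> ((F n <#> K) - F n))"
    using fin F' by (intro card_mono) auto
  also have "\<dots> \<le> card (F n) + card ((F n <#> K) - F n)" by (rule card_Un_le)
  finally have "real (card (F n <#> K)) \<le> real (card (F n)) + real (card ((F n <#> K) - F n))" by linarith
  also have "\<dots> = ?r n * real (card (F n))" using F' by (simp add: field_simps)
  finally show "real (card (F n <#> K)) \<le> ?r n * real (card (F n))" .
qed

text \<open>
A translate is selected whenever the part of it that is not yet covered carries mass at least \<open>m / 2\<close>. The new
parts of the selected translates are disjoint, which bounds the number of selected translates by the mass
covered. Every other translate, and every selected one, has mass at least \<open>m / 2\<close> inside the union of the
selected ones. Measuring overlaps by \<open>w\<close> and not by cardinality makes the covering lemma below work without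
any control on how often the selected translates overlap.
\<close>

lemma greedy_translates:
  fixes w :: "'a \<Rightarrow> real"
  assumes A: "finite A" "A \<subseteq> carrier G" and w: "\<And>g. w g \<ge> 0"
    and B: "finite B" "\<And>a. a \<in> B \<Longrightarrow> m \<le> (\<Sum>g\<in>(\<otimes>) a ` A. w g)"
  shows "\<exists>D\<subseteq>B. real (card D) * (m / 2) \<le> (\<Sum>g\<in>(\<Union>b\<in>D. (\<otimes>) b ` A). w g) \<and>
    (\<forall>a\<in>B. m / 2 \<le> (\<Sum>g\<in>((\<otimes>) a ` A) \<inter> (\<Union>b\<in>D. (\<otimes>) b ` A). w g))"
  using B
proof (induction B rule: finite_induct)
  case (insert a B)
  have fin: "finite ((\<otimes>) g ` A)" for g using A by (simp add: image_iff)
  obtain D where D: "D \<subseteq> B" "real (card D) * (m / 2) \<le> (\<Sum>g\<in>(\<Union>b\<in>D. (\<otimes>) b ` A). w g)"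
    "\<And>a. a \<in> B \<Longrightarrow> m / 2 \<le> (\<Sum>g\<in>((\<otimes>) a ` A) \<inter> (\<Union>b\<in>D. (\<otimes>) b ` A). w g)"
    using insert.IH insert.prems by auto
  let ?U = "\<Union>b\<in>D. (\<otimes>) b ` A"
  have fD: "finite D" using D(1) insert.hyps finite_subset by blast
  have fU: "finite ?U" using fD fin by blast
  show ?case
  proof (cases "m / 2 \<le> (\<Sum>g\<in>((\<otimes>) a ` A) \<inter> ?U. w g)")
    case True
    then show ?thesis using D by (intro exI[of _ D]) auto
  next
    case False
    let ?U' = "\<Union>b\<in>insert a D. (\<otimes>) b ` A"
    have U': "?U' = ((\<otimes>) a ` A - ?U) \<union> ?U" by auto
    have "(\<Sum>g\<in>(\<otimes>) a ` A. w g) = (\<Sum>g\<in>(\<otimes>) a ` A - ?U. w g) + (\<Sum>g\<in>((\<otimes>) a ` A) \<inter> ?U. w g)"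
      using sum.Int_Diff[OF fin[of a], of w ?U] by simp
    then have new: "m / 2 \<le> (\<Sum>g\<in>(\<otimes>) a ` A - ?U. w g)" using False insert.prems[of a] by simp
    have "a \<notin> D" using D(1) insert.hyps by blast
    then have "real (card (insert a D)) * (m / 2) = m / 2 + real (card D) * (m / 2)"
      using fD by (simp add: algebra_simps)
    also have "\<dots> \<le> (\<Sum>g\<in>(\<otimes>) a ` A - ?U. w g) + (\<Sum>g\<in>?U. w g)" using new D(2) by simp
    also have "\<dots> = (\<Sum>g\<in>?U'. w g)"
      unfolding U' by (rule sum.union_disjoint[symmetric]) (use fin fU in auto)
    finally have 1: "real (card (insert a D)) * (m / 2) \<le> (\<Sum>g\<in>?U'. w g)" .
    have 2: "m / 2 \<le> (\<Sum>g\<in>((\<otimes>) c ` A) \<inter> ?U'. w g)" if c: "c \<in> insert a B" for c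
    proof (cases "c = a")
      case True
      have "((\<otimes>) a ` A) \<inter> ?U' = (\<otimes>) a ` A" by auto
      moreover have "m / 2 \<le> (\<Sum>g\<in>(\<otimes>) a ` A. w g)"
        using new sum_mono2[OF fin[of a], of "(\<otimes>) a ` A - ?U" w] w by force
      ultimately show ?thesis using True by simp
    next
      case False
      then have "m / 2 \<le> (\<Sum>g\<in>((\<otimes>) c ` A) \<inter> ?U. w g)" using c D(3) by blast
      also have "\<dots> \<le> (\<Sum>g\<in>((\<otimes>) c ` A) \<inter> ?U'. w g)"
        using fin[of c] w by (intro sum_mono2) auto
      finally show ?thesis .
    qed
    show ?thesis using 1 2 D(1) by (intro exI[of _ "insert a D"]) auto
  qed
qed simp

text \<open>
The covering lemma behind the maximal inequality: if \<open>w\<close> has average at least \<open>t\<close> over the translate \<open>a F (\<nu> a)\<close> for all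
\<open>a \<in> B\<close>, then \<open>t |B|\<close> is at most a constant times the mass of the union of these translates. The
induction peels off the largest index \<open>N\<close>. Let \<open>U\<close> be the union of the translates of \<open>F\<^sub>N\<close> that the greedy
selection yields. The points with index \<open>N\<close> are counted through their mass in \<open>U\<close>; points of smaller
index whose translate meets \<open>b F\<^sub>N\<close>, with \<open>b\<close> selected, lie in \<open>b F\<^sub>N F\<^sub>k\<^sup>-\<^sup>1\<close> for some \<open>k < N\<close>, so that there are at
most \<open>C |F\<^sub>N|\<close> of them for each \<open>b\<close> by temperedness; the translates at the other points are disjoint from
\<open>U\<close>, and the induction hypothesis applies to them.
\<close>

lemma tempered_covering:
  fixes w :: "'a \<Rightarrow> real" and F :: "nat \<Rightarrow> 'a set"
  assumes F: "\<And>n. F n \<subseteq> carrier G" "\<And>n. finite (F n)" "\<And>n. F n \<noteq> {}"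
    and C: "\<And>n. real (card (\<Union>k<n. F k <#> set_inv (F n))) \<le> C * real (card (F n))"
    and w: "\<And>g. w g \<ge> 0" and t: "t > 0"
    and B: "finite B" "B \<subseteq> carrier G" "\<And>a. a \<in> B \<Longrightarrow> \<nu> a < N"
      "\<And>a. a \<in> B \<Longrightarrow> t * real (card (F (\<nu> a))) \<le> (\<Sum>g\<in>(\<otimes>) a ` F (\<nu> a). w g)"
  shows "t * real (card B) \<le> (2 + 2 * C) * (\<Sum>g\<in>(\<Union>a\<in>B. (\<otimes>) a ` F (\<nu> a)). w g)"
  using B
proof (induction N arbitrary: B)
  case 0
  then have "B = {}" by auto
  then show ?case by simp
next
  case (Suc N)
  let ?A = "F N"
  define top where "top = {a \<in> B. \<nu> a = N}"
  have fin: "finite ((\<otimes>) g ` F n)" for g n using F(2)[of n] by (simp add: image_iff)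
  have cA: "card ?A > 0" using F by (simp add: card_gt_0_iff)
  have ftop: "finite top" using Suc.prems by (simp add: top_def)
  have "\<exists>D\<subseteq>top. real (card D) * (t * card ?A / 2) \<le> (\<Sum>g\<in>(\<Union>b\<in>D. (\<otimes>) b ` ?A). w g) \<and>
    (\<forall>a\<in>top. t * card ?A / 2 \<le> (\<Sum>g\<in>((\<otimes>) a ` ?A) \<inter> (\<Union>b\<in>D. (\<otimes>) b ` ?A). w g))"
    by (rule greedy_translates) (use F w ftop Suc.prems(4) in \<open>auto simp: top_def\<close>)
  then obtain D where D: "D \<subseteq> top" "real (card D) * (t * card ?A / 2) \<le> (\<Sum>g\<in>(\<Union>b\<in>D. (\<otimes>) b ` ?A). w g)"
    "\<And>a. a \<in> top \<Longrightarrow> t * card ?A / 2 \<le> (\<Sum>g\<in>((\<otimes>) a ` ?A) \<inter> (\<Union>b\<in>D. (\<otimes>) b ` ?A). w g)" by blast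
  define U where "U = (\<Union>b\<in>D. (\<otimes>) b ` ?A)"
  define W where "W = (\<Sum>g\<in>U. w g)"
  have fD: "finite D" using D(1) ftop finite_subset by blast
  have fU: "finite U" unfolding U_def using fD fin by blast
  have Dc: "D \<subseteq> carrier G" using D(1) Suc.prems(2) by (auto simp: top_def)
  have Uc: "U \<subseteq> carrier G" using F(1)[of N] Dc by (auto simp: U_def image_iff)
  define low where "low = {a \<in> B. \<nu> a < N \<and> ((\<otimes>) a ` F (\<nu> a)) \<inter> U = {}}"
  define hit where "hit = {a \<in> B. \<nu> a < N \<and> ((\<otimes>) a ` F (\<nu> a)) \<inter> U \<noteq> {}}"
  define V where "V = (\<Union>a\<in>low. (\<otimes>) a ` F (\<nu> a))"
  \<comment> \<open>Each point of \<open>U\<close> lies in at most \<open>card (F N)\<close> of the translates \<open>a F\<^sub>N\<close>.\<close>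
  have top: "t * real (card top) \<le> 2 * W"
  proof -
    have "real (card top) * (t * card ?A / 2) = (\<Sum>a\<in>top. t * card ?A / 2)" by simp
    also have "\<dots> \<le> (\<Sum>a\<in>top. \<Sum>g\<in>((\<otimes>) a ` ?A) \<inter> U. w g)" using D(3) by (intro sum_mono) (simp add: U_def)
    also have "\<dots> = (\<Sum>a\<in>top. \<Sum>g\<in>U. if g \<in> (\<otimes>) a ` ?A then w g else 0)"
      using fU by (simp add: sum.inter_restrict Int_commute)
    also have "\<dots> = (\<Sum>g\<in>U. \<Sum>a\<in>top. if g \<in> (\<otimes>) a ` ?A then w g else 0)" by (rule sum.swap)
    also have "\<dots> = (\<Sum>g\<in>U. real (card {a \<in> top. g \<in> (\<otimes>) a ` ?A}) * w g)"
      using ftop by (simp add: sum.inter_filter[symmetric])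
    also have "\<dots> \<le> (\<Sum>g\<in>U. real (card ?A) * w g)"
    proof (intro sum_mono mult_right_mono w of_nat_mono)
      fix g assume g: "g \<in> U"
      have "{a \<in> top. g \<in> (\<otimes>) a ` ?A} \<subseteq> (\<lambda>f. g \<otimes> inv f) ` ?A"
      proof
        fix a assume a: "a \<in> {a \<in> top. g \<in> (\<otimes>) a ` ?A}"
        then obtain f where f: "f \<in> ?A" "g = a \<otimes> f" by (auto simp: image_iff)
        moreover have "a \<in> carrier G" "f \<in> carrier G" using a f F(1) Suc.prems(2) by (auto simp: top_def)
        ultimately have "a = g \<otimes> inv f" by (simp add: m_assoc)
        then show "a \<in> (\<lambda>f. g \<otimes> inv f) ` ?A" using f by blast
      qed
      then show "card {a \<in> top. g \<in> (\<otimes>) a ` ?A} \<le> card ?A" using F(2) by (rule surj_card_le[rotated])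
    qed
    also have "\<dots> = card ?A * W" by (simp add: W_def sum_distrib_left)
    finally show ?thesis using cA by (simp add: field_simps)
  qed
  have hit: "t * real (card hit) \<le> 2 * C * W"
  proof -
    let ?X = "\<Union>k<N. F k <#> set_inv ?A"
    have fX: "finite ?X" using F(2) by (auto simp: set_mult_def SET_INV_def)
    have "hit \<subseteq> (\<Union>b\<in>D. (\<lambda>s. b \<otimes> inv s) ` ?X)"
    proof
      fix a assume a: "a \<in> hit"
      then obtain b f f' where *: "b \<in> D" "f \<in> F (\<nu> a)" "f' \<in> ?A" "a \<otimes> f = b \<otimes> f'" and N: "\<nu> a < N"
        by (auto simp: hit_def U_def image_iff)
      have c: "a \<in> carrier G" "b \<in> carrier G" "f \<in> carrier G" "f' \<in> carrier G"
        using a * Dc F(1) Suc.prems(2) by (auto simp: hit_def)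
      have "a = a \<otimes> f \<otimes> inv f" using c by (simp add: m_assoc)
      also have "\<dots> = b \<otimes> inv (f \<otimes> inv f')" using c *(4) by (simp add: inv_mult_group m_assoc)
      finally have "a = b \<otimes> inv (f \<otimes> inv f')" .
      moreover have "f \<otimes> inv f' \<in> ?X" using * N by (auto simp: set_mult_def SET_INV_def)
      ultimately show "a \<in> (\<Union>b\<in>D. (\<lambda>s. b \<otimes> inv s) ` ?X)" using *(1) by blast
    qed
    then have "card hit \<le> card (\<Union>b\<in>D. (\<lambda>s. b \<otimes> inv s) ` ?X)"
      using fD fX by (intro card_mono) auto
    also have "\<dots> \<le> (\<Sum>b\<in>D. card ((\<lambda>s. b \<otimes> inv s) ` ?X))" by (rule card_UN_le[OF fD])
    also have "\<dots> \<le> (\<Sum>b\<in>D. card ?X)" by (intro sum_mono card_image_le fX)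
    finally have "card hit \<le> card D * card ?X" by simp
    then have "real (card hit) \<le> real (card D) * real (card ?X)" by (simp flip: of_nat_mult)
    also have "\<dots> \<le> real (card D) * (C * card ?A)" using C by (intro mult_left_mono) auto
    finally have "t * real (card hit) \<le> t * (real (card D) * (C * card ?A))" using t by simp
    also have "\<dots> = 2 * C * (real (card D) * (t * card ?A / 2))" by (simp add: field_simps)
    also have "\<dots> \<le> 2 * C * W"
    proof (rule mult_left_mono)
      have "0 \<le> C * real (card ?A)" using C[of N] by (metis of_nat_0_le_iff order_trans)
      then show "0 \<le> 2 * C" using cA by (simp add: zero_le_mult_iff)
    qed (use D(2) in \<open>simp add: W_def U_def\<close>)
    finally show ?thesis .
  qed
  have low: "t * real (card low) \<le> (2 + 2 * C) * (\<Sum>g\<in>V. w g)"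
    unfolding V_def by (rule Suc.IH) (use Suc.prems in \<open>auto simp: low_def\<close>)
  have "B = top \<union> (hit \<union> low)" using Suc.prems(3) by (force simp: top_def hit_def low_def less_Suc_eq)
  then have "card B \<le> card top + (card hit + card low)"
    using card_Un_le[of top "hit \<union> low"] card_Un_le[of hit low] by simp
  then have "t * real (card B) \<le> t * (real (card top) + (real (card hit) + real (card low)))"
    using t by (simp flip: of_nat_add)
  also have "\<dots> \<le> (2 + 2 * C) * (W + (\<Sum>g\<in>V. w g))"
    using top hit low by (simp add: algebra_simps)
  also have "\<dots> \<le> (2 + 2 * C) * (\<Sum>g\<in>(\<Union>a\<in>B. (\<otimes>) a ` F (\<nu> a)). w g)"
  proof (rule mult_left_mono)
    have fV: "finite V" using Suc.prems(1) fin by (auto simp: V_def low_def)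
    have "W + (\<Sum>g\<in>V. w g) = (\<Sum>g\<in>U \<union> V. w g)"
      unfolding W_def by (rule sum.union_disjoint[symmetric]) (use fU fV in \<open>auto simp: V_def low_def\<close>)
    also have "\<dots> \<le> (\<Sum>g\<in>(\<Union>a\<in>B. (\<otimes>) a ` F (\<nu> a)). w g)"
    proof (rule sum_mono2)
      show "U \<union> V \<subseteq> (\<Union>a\<in>B. (\<otimes>) a ` F (\<nu> a))"
        using D(1) unfolding U_def V_def low_def top_def by blast
    qed (use Suc.prems(1) fin w in auto)
    finally show "W + (\<Sum>g\<in>V. w g) \<le> (\<Sum>g\<in>(\<Union>a\<in>B. (\<otimes>) a ` F (\<nu> a)). w g)" .
    have "0 \<le> C * real (card ?A)" using C[of N] by (metis of_nat_0_le_iff order_trans)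
    then show "0 \<le> 2 + 2 * C" using cA by (simp add: zero_le_mult_iff)
  qed
  finally show ?case .
qed

end

section \<open>Lindenstrauss' pointwise ergodic theorem for bounded functions\<close>

text \<open>
Right actions fit right F\o lner sequences: the average over \<open>F\<^sub>n\<close> of the function \<open>x \<mapsto> f (T g x)\<close> is
the average of \<open>f\<close> over \<open>F\<^sub>n g\<close>, which is close to the one over \<open>F\<^sub>n\<close>.
\<close>

locale pmp_right_action = group G + prob_space M
  for G :: "('g, 'm) monoid_scheme" (structure) and M :: "'a measure" +
  fixes T :: "'g \<Rightarrow> 'a \<Rightarrow> 'a"
  assumes T_measurable: "g \<in> carrier G \<Longrightarrow> T g \<in> M \<rightarrow>\<^sub>M M"
    and T_preserving: "g \<in> carrier G \<Longrightarrow> distr M M (T g) = M"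
    and T_mult: "\<lbrakk>g \<in> carrier G; h \<in> carrier G; x \<in> space M\<rbrakk> \<Longrightarrow> T (g \<otimes> h) x = T h (T g x)"
begin

definition average :: "'g set \<Rightarrow> ('a \<Rightarrow> real) \<Rightarrow> 'a \<Rightarrow> real" where
  "average A f x = (\<Sum>g\<in>A. f (T g x)) / real (card A)"

definition ergodic :: bool where
  "ergodic \<longleftrightarrow> (\<forall>A\<in>sets M. (\<forall>g\<in>carrier G. T g -` A \<inter> space M = A) \<longrightarrow> prob A = 0 \<or> prob A = 1)"

lemma T_space: "g \<in> carrier G \<Longrightarrow> x \<in> space M \<Longrightarrow> T g x \<in> space M"
  using measurable_space[OF T_measurable] .

lemma measurable_T:
  "g \<in> carrier G \<Longrightarrow> f \<in> M \<rightarrow>\<^sub>M N \<Longrightarrow> (\<lambda>x. f (T g x)) \<in> M \<rightarrow>\<^sub>M N"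
  using measurable_compose[OF T_measurable] .

lemma integrable_T:
  fixes f :: "'a \<Rightarrow> real"
  assumes "g \<in> carrier G" "integrable M f"
  shows "integrable M (\<lambda>x. f (T g x))"
proof (rule integrable_distr[OF T_measurable[OF assms(1)]])
  show "integrable (distr M M (T g)) f"
    unfolding T_preserving[OF assms(1)] by (rule assms(2))
qed

lemma integral_T:
  fixes f :: "'a \<Rightarrow> real"
  assumes "g \<in> carrier G" "f \<in> borel_measurable M"
  shows "(\<integral>x. f (T g x) \<partial>M) = (\<integral>x. f x \<partial>M)"
  using integral_distr[OF T_measurable[OF assms(1)] assms(2)] T_preserving[OF assms(1)] by simp

lemma AE_T:
  assumes "g \<in> carrier G" "AE x in M. R x"
  shows "AE x in M. R (T g x)"
proof -
  have "AE x in distr M M (T g). R x" unfolding T_preserving[OF assms(1)] by (rule assms(2))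
  then show ?thesis by (rule AE_distrD[OF T_measurable[OF assms(1)]])
qed

lemma measurable_average:
  assumes "A \<subseteq> carrier G" "f \<in> borel_measurable M"
  shows "average A f \<in> borel_measurable M"
proof -
  have "(\<lambda>x. f (T g x)) \<in> borel_measurable M" if "g \<in> A" for g
    using measurable_T[of g f borel] that assms by blast
  then show ?thesis unfolding average_def[abs_def]
    by (intro borel_measurable_divide borel_measurable_sum) auto
qed

lemma average_add: "average A (\<lambda>x. f x + h x) x = average A f x + average A h x"
  by (simp add: average_def sum.distrib add_divide_distrib)

lemma average_cmult: "average A (\<lambda>x. c * f x) x = c * average A f x"
  by (simp add: average_def sum_distrib_left)

lemma abs_average_le: "\<bar>average A f x\<bar> \<le> average A (\<lambda>x. \<bar>f x\<bar>) x"
  by (simp add: average_def divide_right_mono)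

text \<open>
The averages of \<open>f\<close> and of its translate differ only by the values at points of \<open>F\<^sub>n g\<close> outside \<open>F\<^sub>n\<close> and
vice versa. Here convergence holds at every point; an exceptional null set enters only through the maximal inequality.
\<close>

lemma average_coboundary:
  assumes F: "right_Folner G F" and g: "g \<in> carrier G" and x: "x \<in> space M"
    and b: "\<And>x. x \<in> space M \<Longrightarrow> \<bar>f x\<bar> \<le> b"
  shows "(\<lambda>n. average (F n) (\<lambda>x. f x - f (T g x)) x) \<longlonglongrightarrow> 0"
proof (rule Lim_null_comparison)
  let ?s = "\<lambda>n. sym_diff (F n #> g) (F n)"
  have "(\<lambda>n. real (card (?s n)) / real (card (F n)) * b) \<longlonglongrightarrow> 0 * b"
    by (intro tendsto_mult tendsto_const) (use F g in \<open>auto simp: right_Folner_def\<close>)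
  then show "(\<lambda>n. real (card (?s n)) / real (card (F n)) * b) \<longlonglongrightarrow> 0" by simp
  have "norm (average (F n) (\<lambda>x. f x - f (T g x)) x) \<le> real (card (?s n)) / real (card (F n)) * b" for n
  proof -
    have F': "F n \<subseteq> carrier G" "finite (F n)" using F by (auto simp: right_Folner_def)
    have im: "F n #> g = (\<lambda>h. h \<otimes> g) ` F n" by (auto simp: r_coset_def)
    have inj: "inj_on (\<lambda>h. h \<otimes> g) (F n)" using F' g by (intro inj_onI) (auto simp: subset_iff)
    have fin: "finite (F n #> g)" using F' by (simp add: im)
    let ?u = "\<lambda>h. f (T h x)"
    have "(\<Sum>h\<in>F n. f (T g (T h x))) = (\<Sum>h\<in>F n. ?u (h \<otimes> g))"
      using F' g x by (intro sum.cong refl) (auto simp: T_mult subset_iff)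
    also have "\<dots> = (\<Sum>h\<in>F n #> g. ?u h)" by (simp add: im sum.reindex[OF inj])
    finally have "(\<Sum>h\<in>F n. f (T h x) - f (T g (T h x))) = (\<Sum>h\<in>F n. ?u h) - (\<Sum>h\<in>F n #> g. ?u h)"
      by (simp add: sum_subtractf)
    also have "\<dots> = (\<Sum>h\<in>F n - (F n #> g). ?u h) - (\<Sum>h\<in>(F n #> g) - F n. ?u h)"
      using sum.Int_Diff[OF F'(2), of ?u "F n #> g"] sum.Int_Diff[OF fin, of ?u "F n"]
      by (simp add: Int_commute)
    also have "\<bar>\<dots>\<bar> \<le> (\<Sum>h\<in>F n - (F n #> g). \<bar>?u h\<bar>) + (\<Sum>h\<in>(F n #> g) - F n. \<bar>?u h\<bar>)"
      by (intro order_trans[OF abs_triangle_ineq4] add_mono sum_abs)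
    also have "\<dots> = (\<Sum>h\<in>?s n. \<bar>?u h\<bar>)"
      using F' fin by (subst sum.union_disjoint[symmetric]) (auto intro!: sum.cong)
    also have "\<dots> \<le> (\<Sum>h\<in>?s n. b)"
    proof (rule sum_mono)
      fix h assume "h \<in> ?s n"
      then have "h \<in> carrier G" using F' g by (auto simp: im)
      then show "\<bar>?u h\<bar> \<le> b" using b T_space x by auto
    qed
    finally have "\<bar>\<Sum>h\<in>F n. f (T h x) - f (T g (T h x))\<bar> \<le> real (card (?s n)) * b" by simp
    then show ?thesis by (simp add: average_def divide_right_mono)
  qed
  then show "\<forall>\<^sub>F n in sequentially. norm (average (F n) (\<lambda>x. f x - f (T g x)) x)
      \<le> real (card (?s n)) / real (card (F n)) * b" by simp
qed

text \<open>
Transference: for a F\o lner set \<open>F\<^sub>m\<close> with \<open>m\<close> large compared to \<open>N\<close>, the points \<open>a \<in> F\<^sub>m\<close> for which \<open>T a x\<close> lies in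
the exceptional set are counted by the covering lemma, in terms of the sum of \<open>h (T g x)\<close> over
\<open>g \<in> F\<^sub>m K\<close> with \<open>K = F\<^sub>0 \<union> \<dots> \<union> F\<^sub>N\<^sub>-\<^sub>1\<close>. Integrating over \<open>x\<close> and using \<open>|F\<^sub>m K| / |F\<^sub>m| \<longlonglongrightarrow> 1\<close> gives the bound,
in which the constant does not depend on \<open>N\<close>.
\<close>

lemma finite_maximal_inequality:
  assumes F: "right_Folner G F"
    and C: "\<And>n. real (card (\<Union>k<n. F k <#> set_inv (F n))) \<le> C * real (card (F n))"
    and h: "integrable M h" "\<And>x. h x \<ge> 0" and t: "t > 0"
  shows "t * prob {x \<in> space M. \<exists>n<N. t \<le> average (F n) h x} \<le> (2 + 2 * C) * (\<integral>x. h x \<partial>M)"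
proof -
  have F': "F n \<subseteq> carrier G" "finite (F n)" "F n \<noteq> {}" for n using F by (auto simp: right_Folner_def)
  have [measurable]: "h \<in> borel_measurable M" using h by auto
  have [measurable]: "average (F n) h \<in> borel_measurable M" for n
    using F' by (intro measurable_average) auto
  define D where "D = {x \<in> space M. \<exists>n<N. t \<le> average (F n) h x}"
  have [measurable]: "D \<in> sets M" unfolding D_def by measurable
  define K where "K = (\<Union>n<N. F n)"
  have K: "finite K" "K \<subseteq> carrier G" using F' by (auto simp: K_def)
  have C0: "C \<ge> 0" using order_trans[OF of_nat_0_le_iff C[of 0]] F'[of 0]
    by (simp add: zero_le_mult_iff card_gt_0_iff)
  obtain r where r: "r \<longlonglongrightarrow> 1" "\<And>m. real (card (F m <#> K)) \<le> r m * real (card (F m))"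
    using right_Folner_growth[OF F K] by blast
  have "t * prob D \<le> (2 + 2 * C) * (\<integral>x. h x \<partial>M) * r m" for m
  proof -
    let ?L = "F m <#> K"
    have L: "finite ?L" "?L \<subseteq> carrier G" using F'(2)[of m] K(1) set_mult_closed[OF F'(1) K(2)] by (simp_all add: set_mult_def)
    \<comment> \<open>The covering lemma is applied along each orbit, to the weights \<open>h (T g x)\<close> on \<open>G\<close>.\<close>
    have pt: "t * (\<Sum>a\<in>F m. indicator D (T a x)) \<le> (2 + 2 * C) * (\<Sum>g\<in>?L. h (T g x))"
      if x: "x \<in> space M" for x
    proof -
      define B where "B = {a \<in> F m. T a x \<in> D}"
      define \<nu> where "\<nu> a = (SOME n. n < N \<and> t \<le> average (F n) h (T a x))" for a
      have \<nu>: "\<nu> a < N \<and> t \<le> average (F (\<nu> a)) h (T a x)" if "a \<in> B" for a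
        unfolding \<nu>_def by (rule someI_ex) (use that in \<open>auto simp: B_def D_def\<close>)
      have B: "finite B" "B \<subseteq> carrier G" using F' by (auto simp: B_def)
      have fin: "finite (\<Union>a\<in>B. (\<otimes>) a ` F (\<nu> a))" using B F' by auto
      have "(\<Sum>a\<in>F m. indicator D (T a x)) = real (card B)"
        using F'(2)[of m] unfolding B_def indicator_def by (simp add: sum.inter_filter[symmetric] Int_def)
      then have "t * (\<Sum>a\<in>F m. indicator D (T a x)) = t * real (card B)" by simp
      also have "\<dots> \<le> (2 + 2 * C) * (\<Sum>g\<in>(\<Union>a\<in>B. (\<otimes>) a ` F (\<nu> a)). h (T g x))"
      proof (rule tempered_covering[OF F' C h(2) t B])
        fix a assume a: "a \<in> B"
        then have ac: "a \<in> carrier G" using B by blast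
        have "t * real (card (F (\<nu> a))) \<le> (\<Sum>g\<in>F (\<nu> a). h (T g (T a x)))"
          using \<nu>[OF a] F'[of "\<nu> a"] by (simp add: average_def field_simps card_gt_0_iff)
        also have "\<dots> = (\<Sum>g\<in>F (\<nu> a). h (T (a \<otimes> g) x))"
          using F' ac x by (intro sum.cong refl) (auto simp: T_mult subset_iff)
        also have "\<dots> = (\<Sum>g\<in>(\<otimes>) a ` F (\<nu> a). h (T g x))"
          using F' ac by (simp add: sum_left_translate)
        finally show "t * real (card (F (\<nu> a))) \<le> (\<Sum>g\<in>(\<otimes>) a ` F (\<nu> a). h (T g x))" .
      qed (use \<nu> in auto)
      also have "(\<Sum>g\<in>(\<Union>a\<in>B. (\<otimes>) a ` F (\<nu> a)). h (T g x)) \<le> (\<Sum>g\<in>?L. h (T g x))"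
      proof (rule sum_mono2[OF L(1)])
        show "(\<Union>a\<in>B. (\<otimes>) a ` F (\<nu> a)) \<subseteq> ?L"
          using \<nu> unfolding set_mult_def K_def B_def by fastforce
      qed (use h in auto)
      finally show ?thesis using C0 by (simp add: mult_left_mono)
    qed
    have int_h: "integrable M (\<lambda>x. h (T g x))" if "g \<in> ?L" for g
      using that h L(2) by (intro integrable_T) auto
    have int_D: "integrable M (\<lambda>x. indicat_real D (T a x))" if "a \<in> F m" for a
      by (intro integrable_T[OF subsetD[OF F'(1) that]] integrable_real_indicator) (auto simp: emeasure_eq_measure)
    have "t * (real (card (F m)) * prob D) = t * (\<Sum>a\<in>F m. \<integral>x. indicat_real D (T a x) \<partial>M)"
    proof -
      have "(\<integral>x. indicat_real D (T a x) \<partial>M) = prob D" if "a \<in> F m" for a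
        using that F' integral_T[of a "indicat_real D"] by auto
      then show ?thesis by simp
    qed
    also have "\<dots> = (\<integral>x. t * (\<Sum>a\<in>F m. indicator D (T a x)) \<partial>M)"
      using int_D by (simp add: Bochner_Integration.integral_sum)
    also have "\<dots> \<le> (\<integral>x. (2 + 2 * C) * (\<Sum>g\<in>?L. h (T g x)) \<partial>M)"
    proof (rule integral_mono)
      show "integrable M (\<lambda>x. t * (\<Sum>a\<in>F m. indicator D (T a x)))"
        using int_D by (intro integrable_mult_right Bochner_Integration.integrable_sum) auto
      show "integrable M (\<lambda>x. (2 + 2 * C) * (\<Sum>g\<in>?L. h (T g x)))"
        using int_h by (intro integrable_mult_right Bochner_Integration.integrable_sum) auto
    qed (rule pt)
    also have "\<dots> = (2 + 2 * C) * (\<Sum>g\<in>?L. \<integral>x. h (T g x) \<partial>M)"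
      using int_h by (simp add: Bochner_Integration.integral_sum)
    also have "(\<Sum>g\<in>?L. \<integral>x. h (T g x) \<partial>M) = (\<Sum>g\<in>?L. \<integral>x. h x \<partial>M)"
      using L by (intro sum.cong refl integral_T) auto
    also have "\<dots> = real (card ?L) * (\<integral>x. h x \<partial>M)" by simp
    finally have "t * (real (card (F m)) * prob D) \<le> (2 + 2 * C) * (real (card ?L) * (\<integral>x. h x \<partial>M))" .
    also have "\<dots> \<le> (2 + 2 * C) * ((r m * real (card (F m))) * (\<integral>x. h x \<partial>M))"
      using C0 h(2) r(2) by (intro mult_left_mono mult_right_mono) auto
    finally have "real (card (F m)) * (t * prob D) \<le> real (card (F m)) * ((2 + 2 * C) * (\<integral>x. h x \<partial>M) * r m)"
      by (simp add: mult_ac)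
    then show ?thesis using F'[of m] by (simp add: card_gt_0_iff)
  qed
  moreover have "(\<lambda>m. (2 + 2 * C) * (\<integral>x. h x \<partial>M) * r m) \<longlonglongrightarrow> (2 + 2 * C) * (\<integral>x. h x \<partial>M) * 1"
    using r(1) by (intro tendsto_mult tendsto_const)
  ultimately have "t * prob D \<le> (2 + 2 * C) * (\<integral>x. h x \<partial>M) * 1"
    by (intro LIMSEQ_le_const) auto
  then show ?thesis by (simp add: D_def)
qed

lemma maximal_inequality:
  assumes F: "right_Folner G F"
    and C: "\<And>n. real (card (\<Union>k<n. F k <#> set_inv (F n))) \<le> C * real (card (F n))"
    and h: "integrable M h" "\<And>x. h x \<ge> 0" and t: "t > 0"
  shows "t * prob {x \<in> space M. \<exists>n. t \<le> average (F n) h x} \<le> (2 + 2 * C) * (\<integral>x. h x \<partial>M)"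
proof -
  have F': "F n \<subseteq> carrier G" for n using F by (auto simp: right_Folner_def)
  have [measurable]: "average (F n) h \<in> borel_measurable M" for n
    using F' h by (intro measurable_average) auto
  let ?D = "\<lambda>N. {x \<in> space M. \<exists>n<N. t \<le> average (F n) h x}"
  have "(\<lambda>N. prob (?D N)) \<longlonglongrightarrow> prob (\<Union>N. ?D N)"
    by (rule finite_Lim_measure_incseq) (auto simp: incseq_def intro: less_le_trans)
  moreover have "(\<Union>N. ?D N) = {x \<in> space M. \<exists>n. t \<le> average (F n) h x}" by auto
  ultimately have "(\<lambda>N. t * prob (?D N)) \<longlonglongrightarrow> t * prob {x \<in> space M. \<exists>n. t \<le> average (F n) h x}"
    by (intro tendsto_mult tendsto_const) simp
  then show ?thesis
    by (rule LIMSEQ_le_const2) (use finite_maximal_inequality[OF assms] in blast)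
qed

text \<open>
The dyadic convex hull of the translates of \<open>f\<close>. Closure under translations and midpoints is all that the
parallelogram argument for the mean ergodic theorem needs, and \<open>f\<close> differs from each element of the hull by
a combination of coboundaries only.
\<close>

inductive_set mean_hull :: "('a \<Rightarrow> real) \<Rightarrow> ('a \<Rightarrow> real) set" for f where
  base: "f \<in> mean_hull f"
| translate: "k \<in> mean_hull f \<Longrightarrow> g \<in> carrier G \<Longrightarrow> (\<lambda>x. k (T g x)) \<in> mean_hull f"
| midpoint: "k \<in> mean_hull f \<Longrightarrow> k' \<in> mean_hull f \<Longrightarrow> (\<lambda>x. (k x + k' x) / 2) \<in> mean_hull f"

lemma mean_hull_props:
  assumes k: "k \<in> mean_hull f" and f: "f \<in> borel_measurable M" "\<And>x. x \<in> space M \<Longrightarrow> \<bar>f x\<bar> \<le> b"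
  shows "k \<in> borel_measurable M \<and> (\<forall>x\<in>space M. \<bar>k x\<bar> \<le> b) \<and> (\<integral>x. k x \<partial>M) = (\<integral>x. f x \<partial>M)"
  using k
proof induction
  case base
  then show ?case using f by auto
next
  case (translate k g)
  then show ?case using integral_T[of g k] measurable_T[of g k borel] T_space[of g] by auto
next
  case (midpoint k k')
  have "integrable M k" "integrable M k'"
    using midpoint by (auto intro!: integrable_const_bound[where B = b])
  moreover have "\<bar>(k x + k' x) / 2\<bar> \<le> b" if "x \<in> space M" for x
  proof -
    have "\<bar>k x\<bar> \<le> b" "\<bar>k' x\<bar> \<le> b" using midpoint that by auto
    then show ?thesis by (simp add: abs_le_iff)
  qed
  ultimately show ?case using midpoint by auto
qed

lemma average_mean_hull:
  assumes F: "right_Folner G F" and k: "k \<in> mean_hull f" and x: "x \<in> space M"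
    and f: "f \<in> borel_measurable M" "\<And>x. x \<in> space M \<Longrightarrow> \<bar>f x\<bar> \<le> b"
  shows "(\<lambda>n. average (F n) (\<lambda>x. f x - k x) x) \<longlonglongrightarrow> 0"
  using k
proof induction
  case base
  then show ?case by (simp add: average_def)
next
  case (translate k g)
  have "(\<lambda>n. average (F n) (\<lambda>x. k x - k (T g x)) x) \<longlonglongrightarrow> 0"
    by (rule average_coboundary[OF F translate.hyps(2) x, of _ b])
      (use mean_hull_props[OF translate.hyps(1) f] in auto)
  from tendsto_add[OF translate.IH this] show ?case by (simp flip: average_add)
next
  case (midpoint k k')
  have *: "f x - (k x + k' x) / 2 = (1 / 2) * ((f x - k x) + (f x - k' x))" for x
    by (simp add: field_simps)
  have "(\<lambda>n. (1 / 2) * (average (F n) (\<lambda>x. f x - k x) x + average (F n) (\<lambda>x. f x - k' x) x))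
      \<longlonglongrightarrow> (1 / 2) * (0 + 0)"
    by (intro tendsto_mult tendsto_add tendsto_const midpoint.IH)
  then show ?case unfolding * average_cmult average_add by simp
qed

lemma integrable_bounded:
  fixes u :: "'a \<Rightarrow> real"
  assumes "u \<in> borel_measurable M" "\<And>x. x \<in> space M \<Longrightarrow> \<bar>u x\<bar> \<le> b"
  shows "integrable M u"
  using assms by (intro integrable_const_bound[where B = b]) auto

lemma L1_le_L2:
  fixes u :: "'a \<Rightarrow> real"
  assumes u: "integrable M u" "integrable M (\<lambda>x. (u x)\<^sup>2)" and e: "e > 0" "(\<integral>x. (u x)\<^sup>2 \<partial>M) \<le> e\<^sup>2"
  shows "(\<integral>x. \<bar>u x\<bar> \<partial>M) \<le> e"
proof -
  have "\<bar>u x\<bar> \<le> e / 2 + (u x)\<^sup>2 / (2 * e)" for x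
  proof -
    have "2 * \<bar>u x\<bar> * e \<le> e\<^sup>2 + (u x)\<^sup>2"
      using sum_squares_bound[of "\<bar>u x\<bar>" e] by simp
    then show ?thesis using e(1) by (simp add: field_simps power2_eq_square)
  qed
  then have "(\<integral>x. \<bar>u x\<bar> \<partial>M) \<le> (\<integral>x. e / 2 + (u x)\<^sup>2 / (2 * e) \<partial>M)"
    using u by (intro integral_mono) auto
  also have "\<dots> = e / 2 + (\<integral>x. (u x)\<^sup>2 \<partial>M) / (2 * e)"
    using u by (simp add: prob_space)
  also have "\<dots> \<le> e / 2 + e\<^sup>2 / (2 * e)" using e by (intro add_mono divide_right_mono) auto
  also have "\<dots> = e" using e(1) by (simp add: power2_eq_square)
  finally show ?thesis .
qed

text \<open>
Ergodicity only speaks of strictly invariant sets, whereas \<open>l\<close> is invariant up to null sets. Requiring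
\<open>l (T g x) > 0\<close> for all \<open>g\<close> at once gives a strictly invariant set, which differs from \<open>{x. l x > 0}\<close> by a
null set since \<open>G\<close> is countable. It cannot have full measure because the integral of \<open>l\<close> vanishes.
\<close>

lemma invariant_nonpositive:
  assumes G: "countable (carrier G)" and erg: ergodic
    and l: "integrable M l" "(\<integral>x. l x \<partial>M) = 0"
    and inv: "\<And>g. g \<in> carrier G \<Longrightarrow> AE x in M. l (T g x) = l x"
  shows "AE x in M. l x \<le> (0::real)"
proof -
  have [measurable]: "l \<in> borel_measurable M" using l by auto
  have [measurable]: "(\<lambda>x. l (T g x)) \<in> borel_measurable M" if "g \<in> carrier G" for g
    using that by (intro measurable_T) auto
  define A where "A = {x \<in> space M. \<forall>g\<in>carrier G. l (T g x) > 0}"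
  have "A = (\<Inter>g\<in>carrier G. {x \<in> space M. l (T g x) > 0})" using one_closed by (auto simp: A_def)
  also have "\<dots> \<in> sets M"
    using one_closed by (intro sets.countable_INT' G) auto
  finally have A: "A \<in> sets M" .
  have "T h -` A \<inter> space M = A" if h: "h \<in> carrier G" for h
  proof (intro Set.set_eqI iffI)
    fix x assume "x \<in> T h -` A \<inter> space M"
    then have x: "x \<in> space M" and *: "\<And>g. g \<in> carrier G \<Longrightarrow> l (T g (T h x)) > 0" by (auto simp: A_def)
    have "l (T g x) > 0" if g: "g \<in> carrier G" for g
    proof -
      have "g = h \<otimes> (inv h \<otimes> g)" using g h by (simp add: m_assoc[symmetric])
      then have "T g x = T (inv h \<otimes> g) (T h x)"
        using T_mult[of h "inv h \<otimes> g" x] g h x by simp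
      then show ?thesis using *[of "inv h \<otimes> g"] g h by simp
    qed
    then show "x \<in> A" using x by (simp add: A_def)
  next
    fix x assume "x \<in> A"
    then show "x \<in> T h -` A \<inter> space M"
      using h T_space by (auto simp: A_def T_mult[symmetric])
  qed
  then have "prob A = 0 \<or> prob A = 1" using erg A by (auto simp: ergodic_def)
  moreover have AE: "AE x in M. \<forall>g\<in>carrier G. l (T g x) = l x"
    using inv by (simp add: AE_ball_countable[OF G])
  moreover have "prob A \<noteq> 1"
  proof
    assume "prob A = 1"
    then have "AE x in M. x \<in> A" using prob_eq_1[OF A] by simp
    then have pos: "AE x in M. l x > 0"
      using AE by eventually_elim (use one_closed in \<open>force simp: A_def\<close>)
    then have "AE x in M. 0 \<le> l x" by eventually_elim simp
    then have "AE x in M. l x = 0" using integral_nonneg_eq_0_iff_AE[OF l(1)] l(2) by simp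
    with pos have "AE x in M. False" by eventually_elim simp
    then show False by simp
  qed
  ultimately have "prob A = 0" by blast
  then have "AE x in M. x \<notin> A" using A by (simp add: prob_eq_0)
  with AE AE_space show ?thesis by eventually_elim (force simp: A_def not_less)
qed

text \<open>
Let \<open>d\<close> be the infimum of the squared norms on the hull. A minimising sequence is Cauchy by the parallelogram
law, so a subsequence converges almost everywhere. Its limit \<open>l\<close> is invariant because a translate of a nearly
minimal element is again nearly minimal, hence close to it. By ergodicity \<open>l = 0\<close>, so that the subsequence tends
to 0 in mean.
\<close>

lemma mean_ergodic:
  assumes G: "countable (carrier G)" and erg: ergodic
    and f: "f \<in> borel_measurable M" "\<And>x. x \<in> space M \<Longrightarrow> \<bar>f x\<bar> \<le> b" "(\<integral>x. f x \<partial>M) = 0"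
    and e: "e > 0"
  obtains k where "k \<in> mean_hull f" "(\<integral>x. \<bar>k x\<bar> \<partial>M) < e"
proof -
  note hp = mean_hull_props[OF _ f(1,2)]
  let ?H = "mean_hull f"
  let ?n2 = "\<lambda>u. \<integral>x. (u x :: real)\<^sup>2 \<partial>M"
  have [measurable]: "k \<in> borel_measurable M" if "k \<in> ?H" for k using hp[OF that] by blast
  have bd: "\<bar>k x\<bar> \<le> b" if "k \<in> ?H" "x \<in> space M" for k x using hp[OF that(1)] that by blast
  have int0: "(\<integral>x. k x \<partial>M) = 0" if "k \<in> ?H" for k using hp[OF that] f(3) by simp
  have int_mult: "integrable M (\<lambda>x. k x * k' x)" if "k \<in> ?H" "k' \<in> ?H" for k k'
  proof (rule integrable_bounded[where b = "b * b"])
    fix x assume x: "x \<in> space M"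
    show "\<bar>k x * k' x\<bar> \<le> b * b"
      using bd[OF that(1) x] bd[OF that(2) x] by (simp add: abs_mult mult_mono')
  qed (use that in measurable)
  have int: "integrable M k" if "k \<in> ?H" for k
    using that bd[OF that] by (intro integrable_bounded[where b = b]) auto
  have int_diff2: "integrable M (\<lambda>x. (k x - k' x)\<^sup>2)" if "k \<in> ?H" "k' \<in> ?H" for k k'
  proof -
    have "(\<lambda>x. (k x - k' x)\<^sup>2) = (\<lambda>x. k x * k x - 2 * (k x * k' x) + k' x * k' x)"
      by (auto simp: power2_eq_square algebra_simps)
    then show ?thesis
      using int_mult[OF that(1,1)] int_mult[OF that] int_mult[OF that(2,2)] by simp
  qed
  define d where "d = (INF k\<in>?H. ?n2 k)"
  have bdd: "bdd_below (?n2 ` ?H)" by (intro bdd_belowI[where m = 0]) auto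
  have d_le: "d \<le> ?n2 k" if "k \<in> ?H" for k unfolding d_def using bdd that by (rule cINF_lower)
  have "\<exists>k\<in>?H. ?n2 k < d + \<delta>" if "\<delta> > 0" for \<delta>
  proof -
    have "(INF k\<in>?H. ?n2 k) < d + \<delta>" using that by (simp add: d_def)
    then show ?thesis using mean_hull.base bdd by (subst (asm) cINF_less_iff) auto
  qed
  then have "\<forall>n. \<exists>k. k \<in> ?H \<and> ?n2 k < d + 1 / real (Suc n)" by (metis of_nat_0_less_iff zero_less_Suc zero_less_divide_1_iff)
  then obtain s where s: "\<And>n. s n \<in> ?H" "\<And>n. ?n2 (s n) < d + 1 / real (Suc n)" by metis
  \<comment> \<open>Parallelogram law: midpoints stay in the hull, so nearly minimal elements are close.\<close>
  have par: "(\<integral>x. \<bar>k x - k' x\<bar> \<partial>M) \<le> \<delta>"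
    if "k \<in> ?H" "k' \<in> ?H" "?n2 k < d + \<delta>\<^sup>2 / 4" "?n2 k' < d + \<delta>\<^sup>2 / 4" "\<delta> > 0" for k k' \<delta>
  proof (rule L1_le_L2)
    have "d \<le> (\<integral>x. ((k x + k' x) / 2)\<^sup>2 \<partial>M)" using d_le[OF mean_hull.midpoint[OF that(1,2)]] .
    moreover have "(\<integral>x. ((k x + k' x) / 2)\<^sup>2 \<partial>M) = (?n2 k + 2 * (\<integral>x. k x * k' x \<partial>M) + ?n2 k') / 4"
    proof -
      have "(\<integral>x. ((k x + k' x) / 2)\<^sup>2 \<partial>M) = (\<integral>x. (k x * k x + 2 * (k x * k' x) + k' x * k' x) / 4 \<partial>M)"
        by (intro Bochner_Integration.integral_cong) (auto simp: power2_eq_square field_simps)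
      then show ?thesis using int_mult[OF that(1,1)] int_mult[OF that(1,2)] int_mult[OF that(2,2)]
        by (simp add: power2_eq_square)
    qed
    moreover have "(\<integral>x. (k x - k' x)\<^sup>2 \<partial>M) = ?n2 k - 2 * (\<integral>x. k x * k' x \<partial>M) + ?n2 k'"
    proof -
      have "(\<integral>x. (k x - k' x)\<^sup>2 \<partial>M) = (\<integral>x. k x * k x - 2 * (k x * k' x) + k' x * k' x \<partial>M)"
        by (intro Bochner_Integration.integral_cong) (auto simp: power2_eq_square field_simps)
      then show ?thesis using int_mult[OF that(1,1)] int_mult[OF that(1,2)] int_mult[OF that(2,2)]
        by (simp add: power2_eq_square)
    qed
    ultimately show "(\<integral>x. (k x - k' x)\<^sup>2 \<partial>M) \<le> \<delta>\<^sup>2" using that(3,4) by argo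
  qed (use that int int_diff2 in auto)
  have small: "\<exists>N. \<forall>i\<ge>N. ?n2 (s i) < d + \<delta>\<^sup>2 / 4" if "\<delta> > 0" for \<delta>
  proof -
    have "0 < \<delta>\<^sup>2 / 4" using that by simp
    then obtain N where N: "1 / real (Suc N) < \<delta>\<^sup>2 / 4" by (meson nat_approx_posE)
    have "?n2 (s i) < d + \<delta>\<^sup>2 / 4" if "i \<ge> N" for i
    proof -
      have "1 / real (Suc i) \<le> 1 / real (Suc N)" using that by (simp add: frac_le)
      then show ?thesis using s(2)[of i] N by linarith
    qed
    then show ?thesis by blast
  qed
  have "\<exists>N. \<forall>i\<ge>N. \<forall>j\<ge>N. (\<integral>x. norm (s i x - s j x) \<partial>M) < \<delta>" if "\<delta> > 0" for \<delta>
  proof -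
    obtain N where N: "\<And>i. i \<ge> N \<Longrightarrow> ?n2 (s i) < d + (\<delta> / 2)\<^sup>2 / 4" using small[of "\<delta> / 2"] \<open>\<delta> > 0\<close> by auto
    have "(\<integral>x. norm (s i x - s j x) \<partial>M) < \<delta>" if "i \<ge> N" "j \<ge> N" for i j
      using par[OF s(1) s(1) N[OF that(1)] N[OF that(2)]] \<open>\<delta> > 0\<close> by simp
    then show ?thesis by blast
  qed
  then obtain r where r: "strict_mono r" "AE x in M. Cauchy (\<lambda>i. s (r i) x)"
    using cauchy_L1_AE_cauchy_subseq[of M s] int s(1) by blast
  define l where "l x = lim (\<lambda>i. s (r i) x)" for x
  have [measurable]: "s i \<in> borel_measurable M" for i using s by auto
  have l_meas[measurable]: "l \<in> borel_measurable M" unfolding l_def by measurable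
  have conv: "AE x in M. (\<lambda>i. s (r i) x) \<longlonglongrightarrow> l x"
    using r(2) by eventually_elim (simp add: l_def Cauchy_convergent_iff convergent_LIMSEQ_iff)
  have dom: "AE x in M. norm (s (r i) x) \<le> b" for i using bd[OF s(1)] by (intro AE_I2) simp
  have l_int: "integrable M l"
    by (rule integrable_dominated_convergence[OF _ _ _ conv dom]) auto
  have "(\<lambda>i. \<integral>x. s (r i) x \<partial>M) \<longlonglongrightarrow> (\<integral>x. l x \<partial>M)"
    by (rule integral_dominated_convergence[OF _ _ _ conv dom]) auto
  then have l0: "(\<integral>x. l x \<partial>M) = 0" using int0[OF s(1)] by (simp add: LIMSEQ_const_iff)
  have inv: "AE x in M. l (T g x) = l x" if g: "g \<in> carrier G" for g
  proof -
    have [measurable]: "(\<lambda>x. l (T g x)) \<in> borel_measurable M" "(\<lambda>x. s i (T g x)) \<in> borel_measurable M" for i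
      using g by (auto intro: measurable_T)
    have conv_g: "AE x in M. (\<lambda>i. s (r i) (T g x)) \<longlonglongrightarrow> l (T g x)" by (rule AE_T[OF g conv])
    have "(\<lambda>i. \<integral>x. \<bar>s (r i) (T g x) - s (r i) x\<bar> \<partial>M) \<longlonglongrightarrow> (\<integral>x. \<bar>l (T g x) - l x\<bar> \<partial>M)"
    proof (rule integral_dominated_convergence[where w = "\<lambda>_. 2 * b"])
      show "AE x in M. (\<lambda>i. \<bar>s (r i) (T g x) - s (r i) x\<bar>) \<longlonglongrightarrow> \<bar>l (T g x) - l x\<bar>"
        using conv conv_g by eventually_elim (intro tendsto_intros)
      show "AE x in M. norm \<bar>s (r i) (T g x) - s (r i) x\<bar> \<le> 2 * b" for i
      proof (rule AE_I2)
        fix x assume x: "x \<in> space M"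
        show "norm \<bar>s (r i) (T g x) - s (r i) x\<bar> \<le> 2 * b"
          using bd[OF s(1) x, of "r i"] bd[OF s(1) T_space[OF g x], of "r i"] by simp
      qed
    qed auto
    moreover have "(\<lambda>i. \<integral>x. \<bar>s (r i) (T g x) - s (r i) x\<bar> \<partial>M) \<longlonglongrightarrow> 0"
    proof (rule LIMSEQ_I)
      fix \<epsilon> :: real assume \<epsilon>: "\<epsilon> > 0"
      obtain N where N: "\<And>i. i \<ge> N \<Longrightarrow> ?n2 (s i) < d + (\<epsilon> / 2)\<^sup>2 / 4" using small[of "\<epsilon> / 2"] \<epsilon> by auto
      have "norm ((\<integral>x. \<bar>s (r i) (T g x) - s (r i) x\<bar> \<partial>M) - 0) < \<epsilon>" if i: "i \<ge> N" for i
      proof -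
        have ri: "r i \<ge> N" using i r(1) seq_suble[of r i] by linarith
        have "(\<integral>x. (s (r i) (T g x))\<^sup>2 \<partial>M) = ?n2 (s (r i))"
          by (rule integral_T[OF g]) auto
        then have "(\<integral>x. \<bar>s (r i) (T g x) - s (r i) x\<bar> \<partial>M) \<le> \<epsilon> / 2"
          using N[OF ri] \<epsilon> by (intro par mean_hull.translate s g) auto
        then show ?thesis using \<epsilon> by (simp add: abs_of_nonneg)
      qed
      then show "\<exists>N. \<forall>i\<ge>N. norm ((\<integral>x. \<bar>s (r i) (T g x) - s (r i) x\<bar> \<partial>M) - 0) < \<epsilon>" by blast
    qed
    ultimately have "(\<integral>x. \<bar>l (T g x) - l x\<bar> \<partial>M) = 0" by (rule LIMSEQ_unique)
    moreover have "integrable M (\<lambda>x. \<bar>l (T g x) - l x\<bar>)" using integrable_T[OF g l_int] l_int by auto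
    ultimately have "AE x in M. \<bar>l (T g x) - l x\<bar> = 0" by (subst (asm) integral_nonneg_eq_0_iff_AE) auto
    then show ?thesis by eventually_elim simp
  qed
  have "AE x in M. l x \<le> 0" by (rule invariant_nonpositive[OF G erg l_int l0 inv])
  moreover have "AE x in M. - l x \<le> 0"
    by (rule invariant_nonpositive[OF G erg]) (use l_int l0 inv in auto)
  ultimately have l_zero: "AE x in M. l x = 0" by eventually_elim simp
  have "(\<lambda>i. \<integral>x. \<bar>s (r i) x\<bar> \<partial>M) \<longlonglongrightarrow> (\<integral>x. 0 \<partial>M)"
  proof (rule integral_dominated_convergence[where w = "\<lambda>_. b"])
    show "AE x in M. (\<lambda>i. \<bar>s (r i) x\<bar>) \<longlonglongrightarrow> 0"
      using conv l_zero by eventually_elim (simp add: tendsto_rabs_zero_iff)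
  qed (use dom in auto)
  then have "\<forall>\<^sub>F i in sequentially. (\<integral>x. \<bar>s (r i) x\<bar> \<partial>M) < e"
    using e by (intro order_tendstoD(2)) auto
  then obtain i where "(\<integral>x. \<bar>s (r i) x\<bar> \<partial>M) < e" by (auto simp: eventually_sequentially)
  then show ?thesis using that s(1) by blast
qed

text \<open>
For centred \<open>u\<close> and \<open>k\<close> in the hull of \<open>u\<close>, the averages of \<open>u - k\<close> tend to 0 everywhere, while those of \<open>k\<close>
exceed \<open>e\<close> only on a set of measure at most a constant times the \<open>L\<^sup>1\<close>-norm of \<open>k\<close>, divided by \<open>e\<close>. The mean ergodic
theorem makes this norm arbitrarily small.
\<close>

theorem pointwise_ergodic:
  assumes G: "countable (carrier G)" and erg: ergodic
    and F: "right_Folner G F" "tempered G F"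
    and f: "f \<in> borel_measurable M" "\<And>x. x \<in> space M \<Longrightarrow> \<bar>f x\<bar> \<le> b"
  shows "AE x in M. (\<lambda>n. average (F n) f x) \<longlonglongrightarrow> (\<integral>x. f x \<partial>M)"
proof -
  obtain C where C: "\<And>n. real (card (\<Union>k<n. F k <#> set_inv (F n))) \<le> C * real (card (F n))"
    and C0: "C > 0" using F(2) by (auto simp: tempered_def)
  have F': "F n \<subseteq> carrier G" "finite (F n)" "F n \<noteq> {}" for n using F(1) by (auto simp: right_Folner_def)
  have f_int: "integrable M f" using f by (rule integrable_bounded)
  define c where "c = (\<integral>x. f x \<partial>M)"
  define u where "u x = f x - c" for x
  have u: "u \<in> borel_measurable M" "\<And>x. x \<in> space M \<Longrightarrow> \<bar>u x\<bar> \<le> b + \<bar>c\<bar>" "(\<integral>x. u x \<partial>M) = 0"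
  proof -
    show "\<bar>u x\<bar> \<le> b + \<bar>c\<bar>" if "x \<in> space M" for x
      using f(2)[OF that] unfolding u_def by linarith
  qed (use f f_int in \<open>auto simp: u_def[abs_def] c_def prob_space\<close>)
  have [measurable]: "average (F n) u \<in> borel_measurable M" for n
    using F' u by (intro measurable_average) auto
  have near: "AE x in M. \<exists>N. \<forall>n\<ge>N. \<bar>average (F n) u x\<bar> < 2 * e" if e: "e > 0" for e
  proof -
    define Z where "Z = {x \<in> space M. \<not> (\<exists>N. \<forall>n\<ge>N. \<bar>average (F n) u x\<bar> < 2 * e)}"
    have Z: "Z \<in> sets M" unfolding Z_def by measurable
    have "e * prob Z \<le> 0 + \<delta>" if \<delta>: "\<delta> > 0" for \<delta>
    proof -
      obtain k where k: "k \<in> mean_hull u" "(\<integral>x. \<bar>k x\<bar> \<partial>M) < \<delta> / (2 + 2 * C)"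
        using mean_ergodic[OF G erg u, of "\<delta> / (2 + 2 * C)"] \<delta> C0 by auto
      have kp: "k \<in> borel_measurable M" "\<And>x. x \<in> space M \<Longrightarrow> \<bar>k x\<bar> \<le> b + \<bar>c\<bar>"
        using mean_hull_props[OF k(1) u(1,2)] by auto
      have k_int: "integrable M k" using kp by (rule integrable_bounded)
      have [measurable]: "average (F n) (\<lambda>x. \<bar>k x\<bar>) \<in> borel_measurable M" for n
        using F' kp by (intro measurable_average) auto
      let ?D = "{x \<in> space M. \<exists>n. e \<le> average (F n) (\<lambda>x. \<bar>k x\<bar>) x}"
      \<comment> \<open>If the averages of \<open>u\<close> exceed \<open>2 e\<close> infinitely often, then those of \<open>k\<close> exceed \<open>e\<close> at least once.\<close>
      have "Z \<subseteq> ?D"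
      proof
        fix x assume x: "x \<in> Z"
        then have xs: "x \<in> space M" by (simp add: Z_def)
        have "(\<lambda>n. average (F n) (\<lambda>x. u x - k x) x) \<longlonglongrightarrow> 0"
          by (rule average_mean_hull[OF F(1) k(1) xs u(1,2)])
        from LIMSEQ_D[OF this e] obtain N where
          N: "\<And>n. n \<ge> N \<Longrightarrow> \<bar>average (F n) (\<lambda>x. u x - k x) x\<bar> < e" by auto
        obtain n where n: "n \<ge> N" "\<bar>average (F n) u x\<bar> \<ge> 2 * e"
          using x by (auto simp: Z_def not_less)
        have "average (F n) u x = average (F n) (\<lambda>x. u x - k x) x + average (F n) k x"
          by (simp flip: average_add)
        then have "e \<le> \<bar>average (F n) k x\<bar>" using N[OF n(1)] n(2) by linarith
        also have "\<dots> \<le> average (F n) (\<lambda>x. \<bar>k x\<bar>) x" by (rule abs_average_le)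
        finally show "x \<in> ?D" using xs by blast
      qed
      then have "e * prob Z \<le> e * prob ?D"
        using e by (intro mult_left_mono finite_measure_mono) measurable
      also have "\<dots> \<le> (2 + 2 * C) * (\<integral>x. \<bar>k x\<bar> \<partial>M)"
        by (rule maximal_inequality[OF F(1) C _ _ e]) (use k_int in auto)
      also have "\<dots> \<le> \<delta>" using k(2) C0 by (simp add: field_simps)
      finally show ?thesis by simp
    qed
    then have "e * prob Z \<le> 0" by (rule field_le_epsilon)
    then have "prob Z = 0" using e by (simp add: mult_le_0_iff measure_le_0_iff)
    then have "AE x in M. x \<notin> Z" using Z by (simp add: prob_eq_0)
    with AE_space show ?thesis by eventually_elim (auto simp: Z_def)
  qed
  have "AE x in M. \<forall>j. \<exists>N. \<forall>n\<ge>N. \<bar>average (F n) u x\<bar> < 2 * (1 / real (Suc j))"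
    unfolding AE_all_countable by (intro allI near) simp
  then show ?thesis
  proof eventually_elim
    case (elim x)
    have "(\<lambda>n. average (F n) u x) \<longlonglongrightarrow> 0"
    proof (rule LIMSEQ_I)
      fix \<epsilon> :: real assume "\<epsilon> > 0"
      then obtain j where "1 / real (Suc j) < \<epsilon> / 2" by (meson half_gt_zero nat_approx_posE)
      moreover obtain N where "\<forall>n\<ge>N. \<bar>average (F n) u x\<bar> < 2 * (1 / real (Suc j))" using elim by blast
      ultimately have "\<forall>n\<ge>N. norm (average (F n) u x - 0) < \<epsilon>" by fastforce
      then show "\<exists>N. \<forall>n\<ge>N. norm (average (F n) u x - 0) < \<epsilon>" by blast
    qed
    moreover have "average (F n) f x = average (F n) u x + c" for n
      using F'[of n] by (simp add: u_def average_def sum_subtractf diff_divide_distrib)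
    ultimately show ?case using tendsto_add[of "\<lambda>n. average (F n) u x" 0 _ "\<lambda>_. c" c] by (simp add: c_def)
  qed
qed

end

section \<open>Finner's inequality for functions of subsets\<close>

text \<open>
Hoelder's inequality for sums of two terms, in the form in which it is needed for Finner's inequality: up to the
factor \<open>c\<close>, superadditivity of the \<open>k\<close>-th root of a product of at least \<open>k\<close> factors. It follows from the inequality
between arithmetic and geometric means, applied to the ratios \<open>a i / (a i + b i)\<close> and
\<open>b i / (a i + b i)\<close>.
\<close>

lemma geometric_mean_superadditive:
  fixes a b :: "'i \<Rightarrow> real"
  assumes J: "finite J" "k \<le> card J" and k: "k > 0" and c: "c \<ge> 0"
    and a: "\<And>i. i \<in> J \<Longrightarrow> a i \<ge> 0" and b: "\<And>i. i \<in> J \<Longrightarrow> b i \<ge> 0"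
    and A: "A \<ge> 0" "A ^ k \<le> c * (\<Prod>i\<in>J. a i)" and B: "B \<ge> 0" "B ^ k \<le> c * (\<Prod>i\<in>J. b i)"
  shows "(A + B) ^ k \<le> c * (\<Prod>i\<in>J. a i + b i)"
proof -
  define M where "M = c * (\<Prod>i\<in>J. a i + b i)"
  have M0: "M \<ge> 0" unfolding M_def using a b c by (intro mult_nonneg_nonneg prod_nonneg) auto
  show ?thesis
  proof (cases "M = 0")
    case True
    then consider "c = 0" | i where "i \<in> J" "a i + b i = 0" unfolding M_def using J(1) by auto
    then have "c * (\<Prod>i\<in>J. a i) = 0 \<and> c * (\<Prod>i\<in>J. b i) = 0"
    proof cases
      case 2
      then have "a i = 0" "b i = 0" using a[of i] b[of i] by auto
      then show ?thesis using 2(1) J(1) by auto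
    qed simp
    then have "A = 0" "B = 0" using A B k by (auto simp: power_le_zero_eq)
    then show ?thesis using M0 k by (simp add: M_def power_0_left)
  next
    case False
    with M0 have M: "M > 0" by simp
    have ab: "a i + b i > 0" if "i \<in> J" for i
      using that a[of i] b[of i] False J(1) unfolding M_def by (cases "a i + b i = 0") auto
    obtain J' where J': "J' \<subseteq> J" "card J' = k" using J(2) by (rule obtain_subset_with_card_n)
    have fJ': "finite J'" using J' J(1) finite_subset by blast
    \<comment> \<open>After normalising \<open>a i + b i\<close> to 1, all but \<open>k\<close> of the factors, which are at most 1, can be dropped.\<close>
    have key: "X \<le> root k M * ((\<Sum>i\<in>J'. x i / (a i + b i)) / k)"
      if X: "X \<ge> 0" "X ^ k \<le> c * (\<Prod>i\<in>J. x i)" and x: "\<And>i. i \<in> J \<Longrightarrow> x i \<ge> 0 \<and> x i \<le> a i + b i"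
      for X and x :: "'i \<Rightarrow> real"
    proof -
      define p where "p i = x i / (a i + b i)" for i
      have p: "0 \<le> p i \<and> p i \<le> 1" if "i \<in> J" for i using x[OF that] ab[OF that] by (simp add: p_def)
      have eq: "x i = (a i + b i) * p i" if "i \<in> J" for i using ab[OF that] by (simp add: p_def)
      have "c * (\<Prod>i\<in>J. x i) = M * (\<Prod>i\<in>J. p i)"
        unfolding M_def using eq by (simp add: prod.distrib)
      also have "(\<Prod>i\<in>J. p i) = (\<Prod>i\<in>J'. p i) * (\<Prod>i\<in>J - J'. p i)"
        using J' J(1) by (metis mult.commute prod.subset_diff)
      also have "\<dots> \<le> (\<Prod>i\<in>J'. p i) * 1"
        using p J' by (intro mult_left_mono prod_le_1 prod_nonneg) auto
      finally have "X ^ k \<le> M * (\<Prod>i\<in>J'. p i)" using X M by simp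
      then have "root k (X ^ k) \<le> root k (M * (\<Prod>i\<in>J'. p i))" using k by simp
      then have "X \<le> root k M * root k (\<Prod>i\<in>J'. p i)"
        using k X by (simp add: real_root_mult real_root_power_cancel)
      moreover have "root k (\<Prod>i\<in>J'. p i) \<le> (\<Sum>i\<in>J'. p i) / k"
      proof -
        have "(\<Prod>i\<in>J'. p i) powr (1 / k) \<le> (\<Sum>i\<in>J'. p i / card J')"
          using arith_geom_mean[of J' p] fJ' J' k p by (cases "J' = {}") (auto simp: subset_iff)
        moreover have "(\<Prod>i\<in>J'. p i) \<ge> 0" using p J' by (intro prod_nonneg) auto
        ultimately show ?thesis using J' k
          by (simp add: root_powr_inverse sum_divide_distrib inverse_eq_divide)
      qed
      ultimately show ?thesis unfolding p_def
        using M k by (meson mult_left_mono order_trans real_root_ge_zero less_imp_le)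
    qed
    have "A \<le> root k M * ((\<Sum>i\<in>J'. a i / (a i + b i)) / k)"
      by (rule key) (use A a b in auto)
    moreover have "B \<le> root k M * ((\<Sum>i\<in>J'. b i / (a i + b i)) / k)"
      by (rule key) (use B a b in auto)
    ultimately have "A + B \<le> root k M * ((\<Sum>i\<in>J'. a i / (a i + b i)) / k + (\<Sum>i\<in>J'. b i / (a i + b i)) / k)"
      by (simp add: distrib_left)
    also have "(\<Sum>i\<in>J'. a i / (a i + b i)) / k + (\<Sum>i\<in>J'. b i / (a i + b i)) / k
        = (\<Sum>i\<in>J'. a i / (a i + b i) + b i / (a i + b i)) / k"
      by (simp add: sum.distrib add_divide_distrib)
    also have "(\<Sum>i\<in>J'. a i / (a i + b i) + b i / (a i + b i)) = (\<Sum>i\<in>J'. 1)"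
    proof (rule sum.cong)
      fix i assume "i \<in> J'"
      then show "a i / (a i + b i) + b i / (a i + b i) = 1"
        using ab[OF subsetD[OF J'(1)], of i] by (simp flip: add_divide_distrib)
    qed simp
    finally have "A + B \<le> root k M" using J' k by simp
    then have "(A + B) ^ k \<le> root k M ^ k" using A B by (intro power_mono) auto
    then show ?thesis using k M0 by (simp add: M_def)
  qed
qed

lemma sum_Pow_insert:
  fixes h :: "'a set \<Rightarrow> real"
  assumes "finite U" "u \<notin> U"
  shows "(\<Sum>S\<in>Pow (insert u U). h S) = (\<Sum>S\<in>Pow U. h S) + (\<Sum>S\<in>Pow U. h (insert u S))"
proof -
  have "inj_on (insert u) (Pow U)" using assms(2) by (intro inj_onI) (metis PowD insert_ident subsetD)
  moreover have "Pow U \<inter> insert u ` Pow U = {}" using assms(2) by auto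
  ultimately show ?thesis using assms(1)
    by (simp add: Pow_insert sum.union_disjoint sum.reindex)
qed

text \<open>
The induction splits the sum according to whether the new point \<open>u\<close> belongs to \<open>S\<close>. Only the factors with
\<open>u \<in> K i\<close> see the difference; there are at least \<open>k\<close> of them, and the previous lemma recombines the two halves.
\<close>

lemma finner_inequality:
  fixes f :: "'i \<Rightarrow> 'a set \<Rightarrow> real"
  assumes "finite U" and I: "finite I" and k: "k > 0" and "\<And>i S. f i S \<ge> 0"
    and "\<And>u. u \<in> U \<Longrightarrow> k \<le> card {i \<in> I. u \<in> K i}"
  shows "(\<Sum>S\<in>Pow U. \<Prod>i\<in>I. f i (S \<inter> K i)) ^ k \<le> (\<Prod>i\<in>I. \<Sum>S\<in>Pow (U \<inter> K i). f i S ^ k)"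
  using assms(1,4,5)
proof (induction U arbitrary: f rule: finite_induct)
  case empty
  then show ?case by (simp add: prod_power_distrib)
next
  case (insert u U)
  define J where "J = {i \<in> I. u \<in> K i}"
  define f' where "f' i S = f i (if u \<in> K i then insert u S else S)" for i S
  define a where "a i = (\<Sum>S\<in>Pow (U \<inter> K i). f i S ^ k)" for i
  define b where "b i = (\<Sum>S\<in>Pow (U \<inter> K i). f' i S ^ k)" for i
  define A where "A = (\<Sum>S\<in>Pow U. \<Prod>i\<in>I. f i (S \<inter> K i))"
  define B where "B = (\<Sum>S\<in>Pow U. \<Prod>i\<in>I. f' i (S \<inter> K i))"
  define c where "c = (\<Prod>i\<in>I - J. a i)"
  have J: "finite J" "J \<subseteq> I" using I by (auto simp: J_def)
  have f'0: "f' i S \<ge> 0" for i S using insert.prems(1) by (simp add: f'_def)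
  have a0: "a i \<ge> 0" and b0: "b i \<ge> 0" for i
    unfolding a_def b_def using insert.prems(1) f'0 by (auto intro!: sum_nonneg)
  have ba: "b i = a i" if "i \<in> I - J" for i using that by (simp add: a_def b_def f'_def J_def)
  have split: "(\<Prod>i\<in>I. g i) = (\<Prod>i\<in>I - J. g i) * (\<Prod>i\<in>J. g i)" for g :: "'i \<Rightarrow> real"
    using prod.subset_diff[OF J(2) I] .
  have "A ^ k \<le> (\<Prod>i\<in>I. a i)" unfolding A_def a_def
    by (rule insert.IH) (use insert.prems in auto)
  then have A: "A ^ k \<le> c * (\<Prod>i\<in>J. a i)" by (simp add: split c_def)
  have "B ^ k \<le> (\<Prod>i\<in>I. b i)" unfolding B_def b_def
    by (rule insert.IH) (use insert.prems f'0 in auto)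
  then have B: "B ^ k \<le> c * (\<Prod>i\<in>J. b i)" using ba by (simp add: split c_def)
  have B_eq: "(\<Sum>S\<in>Pow U. \<Prod>i\<in>I. f i (insert u S \<inter> K i)) = B"
    unfolding B_def f'_def by (intro sum.cong prod.cong refl) auto
  have "(\<Sum>S\<in>Pow (insert u U). \<Prod>i\<in>I. f i (S \<inter> K i)) = A + B"
    using insert.hyps by (simp add: sum_Pow_insert A_def B_eq)
  then have "(\<Sum>S\<in>Pow (insert u U). \<Prod>i\<in>I. f i (S \<inter> K i)) ^ k = (A + B) ^ k" by simp
  also have "\<dots> \<le> c * (\<Prod>i\<in>J. a i + b i)"
  proof (rule geometric_mean_superadditive[OF J(1) _ k])
    show "k \<le> card J" using insert.prems(2)[of u] by (simp add: J_def)
    show "A \<ge> 0" "B \<ge> 0" unfolding A_def B_def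
      using insert.prems(1) f'0 by (auto intro!: sum_nonneg prod_nonneg)
  qed (use a0 b0 A B in \<open>auto simp: c_def intro!: prod_nonneg\<close>)
  also have "\<dots> = (\<Prod>i\<in>I. \<Sum>S\<in>Pow (insert u U \<inter> K i). f i S ^ k)"
  proof -
    have "(\<Sum>S\<in>Pow (insert u U \<inter> K i). f i S ^ k) = a i" if "i \<in> I - J" for i
      using that by (simp add: J_def a_def)
    moreover have "(\<Sum>S\<in>Pow (insert u U \<inter> K i). f i S ^ k) = a i + b i" if "i \<in> J" for i
    proof -
      have "insert u U \<inter> K i = insert u (U \<inter> K i)" using that by (auto simp: J_def)
      then show ?thesis using that insert.hyps
        by (simp add: sum_Pow_insert J_def a_def b_def f'_def)
    qed
    ultimately show ?thesis by (simp add: split c_def)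
  qed
  finally show ?case .
qed

section \<open>Partition functions and Gibbs measures of hardcore models\<close>

context hardcore_model
begin

abbreviation configs :: "('v \<Rightarrow> nat) set" where "configs \<equiv> indep_configs V E"

abbreviation Z :: "'v set \<Rightarrow> real" where "Z \<equiv> partition_function V E lam"

definition weight :: "'v set \<Rightarrow> ('v \<Rightarrow> nat) \<Rightarrow> real" where
  "weight U x = (\<Prod>v\<in>U. lam v ^ x v)"

definition independent :: "'v set \<Rightarrow> bool" where
  "independent S \<longleftrightarrow> (\<forall>u\<in>S. \<forall>v\<in>S. (u, v) \<notin> E)"

definition set_weight :: "'v set \<Rightarrow> real" where
  "set_weight S = (if independent S then \<Prod>v\<in>S. lam v else 0)"

lemma partition_function_eq: "Z U = (\<Sum>x\<in>agreeing_off V E U (\<lambda>_. 0). weight U x)"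
  by (simp add: partition_function_def agreeing_off_def weight_def)

lemma weight_pos: "U \<subseteq> V \<Longrightarrow> weight U x > 0"
  unfolding weight_def using lam_pos by (intro prod_pos) auto

lemma set_weight_nonneg: "S \<subseteq> V \<Longrightarrow> set_weight S \<ge> 0"
  unfolding set_weight_def by (auto intro!: prod_nonneg less_imp_le[OF lam_pos])

lemma configs_iff:
  "x \<in> configs \<longleftrightarrow> x \<in> V \<rightarrow>\<^sub>E {0, 1} \<and> (\<forall>u v. (u, v) \<in> E \<longrightarrow> x u = 1 \<longrightarrow> x v \<noteq> 1)"
  by (auto simp: indep_configs_def)

lemma configs_values: "x \<in> configs \<Longrightarrow> v \<in> V \<Longrightarrow> x v = 0 \<or> x v = 1"
  by (auto simp: indep_configs_def)

text \<open>
Passing from configurations to their sets of occupied vertices makes Finner's inequality applicable.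
\<close>

lemma partition_function_sets:
  assumes U: "finite U" "U \<subseteq> V"
  shows "Z U = (\<Sum>S\<in>Pow U. set_weight S)"
proof -
  have "(\<Sum>S\<in>Pow U. set_weight S) = (\<Sum>S\<in>{S \<in> Pow U. independent S}. \<Prod>v\<in>S. lam v)"
    unfolding set_weight_def using U by (subst sum.inter_filter[symmetric]) auto
  also have "\<dots> = (\<Sum>x\<in>agreeing_off V E U (\<lambda>_. 0). weight U x)"
  proof (rule sum.reindex_bij_witness[where i = "\<lambda>x. {v \<in> V. x v = 1}" and
        j = "\<lambda>S. \<lambda>v\<in>V. if v \<in> S then 1 else 0"])
    fix S assume S: "S \<in> {S \<in> Pow U. independent S}"
    show "(\<lambda>v\<in>V. if v \<in> S then 1 else 0) \<in> agreeing_off V E U (\<lambda>_. 0)"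
      using S E_subset by (auto simp: agreeing_off_def configs_iff independent_def split: if_splits)
    show "{v \<in> V. (\<lambda>v\<in>V. if v \<in> S then 1 else 0 :: nat) v = 1} = S"
      using S U by (auto split: if_splits)
    have "weight U (\<lambda>v\<in>V. if v \<in> S then 1 else 0) = (\<Prod>v\<in>U. if v \<in> S then lam v else 1)"
      unfolding weight_def using U by (intro prod.cong) auto
    also have "\<dots> = (\<Prod>v\<in>S. lam v)"
    proof -
      have "U \<inter> {v. v \<in> S} = S" using S by auto
      then show ?thesis using U by (simp add: prod.If_cases)
    qed
    finally show "weight U (\<lambda>v\<in>V. if v \<in> S then 1 else 0) = (\<Prod>v\<in>S. lam v)" .
  next
    fix x assume x: "x \<in> agreeing_off V E U (\<lambda>_. 0)"
    then have xc: "x \<in> configs" by (simp add: agreeing_off_def)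
    show "{v \<in> V. x v = 1} \<in> {S \<in> Pow U. independent S}"
      using x xc by (force simp: agreeing_off_def configs_iff independent_def)
    show "(\<lambda>v\<in>V. if v \<in> {v \<in> V. x v = 1} then 1 else 0) = x"
    proof
      fix v
      show "(\<lambda>v\<in>V. if v \<in> {v \<in> V. x v = 1} then 1 else 0) v = x v"
        using configs_values[OF xc, of v] xc by (auto simp: configs_iff PiE_def extensional_def)
    qed
  qed
  finally show ?thesis by (simp add: partition_function_eq)
qed

lemma partition_function_mono:
  assumes "finite B" "A \<subseteq> B" "B \<subseteq> V"
  shows "Z A \<le> Z B"
proof -
  have "(\<Sum>S\<in>Pow A. set_weight S) \<le> (\<Sum>S\<in>Pow B. set_weight S)"
    using assms by (intro sum_mono2) (auto intro!: set_weight_nonneg)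
  moreover have "finite A" "A \<subseteq> V" using assms finite_subset by auto
  ultimately show ?thesis using assms by (simp add: partition_function_sets)
qed

lemma partition_function_empty: "Z {} = 1"
  by (simp add: partition_function_sets set_weight_def independent_def)

lemma partition_function_ge_1: "finite U \<Longrightarrow> U \<subseteq> V \<Longrightarrow> Z U \<ge> 1"
  using partition_function_mono[of U "{}"] by (simp add: partition_function_empty)

text \<open>
Finner's inequality for the functions \<open>f\<^sub>i(S) = w(S)\<^sup>1\<^sup>/\<^sup>k\<close>, where \<open>w\<close> is the weight of an independent
set and 0 on the other sets. The multiplicity has to be exactly \<open>k\<close>: then the factors \<open>\<lambda>(v)\<^sup>1\<^sup>/\<^sup>k\<close> multiply to \<open>\<lambda>(v)\<close>
for each \<open>v \<in> S\<close>, while a higher multiplicity would lose weight when \<open>\<lambda>(v) < 1\<close>.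
\<close>

lemma partition_function_Shearer:
  fixes K :: "'i \<Rightarrow> 'v set"
  assumes U: "finite U" "U \<subseteq> V" and I: "finite I" and k: "k > 0"
    and cover: "\<And>u. u \<in> U \<Longrightarrow> card {i \<in> I. u \<in> K i} = k"
  shows "Z U ^ k \<le> (\<Prod>i\<in>I. Z (U \<inter> K i))"
proof -
  \<comment> \<open>Outside \<open>V\<close> the sign of \<open>lam\<close> is arbitrary; the maximum keeps \<open>f\<close> nonnegative on all sets.\<close>
  define f where "f i S = root k (max 0 (set_weight S))" for i :: 'i and S
  have f0: "f i S \<ge> 0" for i S using k by (simp add: f_def)
  have fk: "f i S ^ k = set_weight S" if "S \<subseteq> V" for i S
    using set_weight_nonneg[OF that] k by (simp add: f_def max_def)
  have "Z U = (\<Sum>S\<in>Pow U. set_weight S)" by (rule partition_function_sets[OF U])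
  also have "\<dots> \<le> (\<Sum>S\<in>Pow U. \<Prod>i\<in>I. f i (S \<inter> K i))"
  proof (rule sum_mono)
    fix S assume S: "S \<in> Pow U"
    then have SV: "S \<subseteq> V" and fS: "finite S" using U finite_subset by auto
    show "set_weight S \<le> (\<Prod>i\<in>I. f i (S \<inter> K i))"
    proof (cases "independent S")
      case True
      have "(\<Prod>i\<in>I. f i (S \<inter> K i)) ^ k = (\<Prod>i\<in>I. set_weight (S \<inter> K i))"
        unfolding prod_power_distrib using SV by (intro prod.cong refl fk) auto
      also have "\<dots> = (\<Prod>i\<in>I. \<Prod>v\<in>S. if v \<in> K i then lam v else 1)"
      proof (rule prod.cong[OF refl])
        fix i
        have "independent (S \<inter> K i)" using True by (auto simp: independent_def)
        moreover have "S \<inter> {v. v \<in> K i} = S \<inter> K i" by auto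
        ultimately show "set_weight (S \<inter> K i) = (\<Prod>v\<in>S. if v \<in> K i then lam v else 1)"
          using fS by (simp add: set_weight_def prod.If_cases)
      qed
      also have "\<dots> = (\<Prod>v\<in>S. \<Prod>i\<in>I. if v \<in> K i then lam v else 1)" by (rule prod.swap)
      also have "\<dots> = (\<Prod>v\<in>S. lam v ^ k)"
      proof (rule prod.cong[OF refl])
        fix v assume "v \<in> S"
        then have "card (I \<inter> {i. v \<in> K i}) = k" using cover[of v] S by (auto simp: Int_def)
        then show "(\<Prod>i\<in>I. if v \<in> K i then lam v else 1) = lam v ^ k"
          using I by (simp add: prod.If_cases)
      qed
      also have "\<dots> = set_weight S ^ k" using True by (simp add: set_weight_def prod_power_distrib)
      finally have "(\<Prod>i\<in>I. f i (S \<inter> K i)) = set_weight S"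
        by (rule power_eq_imp_eq_base) (use f0 SV k in \<open>auto intro!: prod_nonneg set_weight_nonneg\<close>)
      then show ?thesis by simp
    next
      case False
      then show ?thesis using f0 by (auto simp: set_weight_def intro!: prod_nonneg)
    qed
  qed
  finally have "Z U ^ k \<le> (\<Sum>S\<in>Pow U. \<Prod>i\<in>I. f i (S \<inter> K i)) ^ k"
    using partition_function_ge_1[OF U] by (intro power_mono) auto
  also have "\<dots> \<le> (\<Prod>i\<in>I. \<Sum>S\<in>Pow (U \<inter> K i). f i S ^ k)"
    by (rule finner_inequality[OF U(1) I k f0]) (use cover in auto)
  also have "\<dots> = (\<Prod>i\<in>I. Z (U \<inter> K i))"
  proof (rule prod.cong[OF refl])
    fix i
    have "(\<Sum>S\<in>Pow (U \<inter> K i). f i S ^ k) = (\<Sum>S\<in>Pow (U \<inter> K i). set_weight S)"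
      using U by (intro sum.cong refl fk) auto
    also have "\<dots> = Z (U \<inter> K i)" using U by (intro partition_function_sets[symmetric]) auto
    finally show "(\<Sum>S\<in>Pow (U \<inter> K i). f i S ^ k) = Z (U \<inter> K i)" .
  qed
  finally show ?thesis .
qed

lemma partition_function_Un_le:
  assumes "finite A" "finite B" "A \<subseteq> V" "B \<subseteq> V" "A \<inter> B = {}"
  shows "Z (A \<union> B) \<le> Z A * Z B"
proof -
  \<comment> \<open>The case \<open>k = 1\<close> of the Shearer inequality, for the cover of \<open>A \<union> B\<close> by \<open>A\<close> and \<open>B\<close>.\<close>
  define K where "K i = (if i then A else B)" for i
  have "card {i \<in> UNIV. u \<in> K i} = 1" if "u \<in> A \<union> B" for u
  proof -
    have "{i \<in> UNIV. u \<in> K i} = {u \<in> A}" using that assms(5) by (auto simp: K_def split: if_splits)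
    then show ?thesis by simp
  qed
  then have "Z (A \<union> B) ^ 1 \<le> (\<Prod>i\<in>UNIV. Z ((A \<union> B) \<inter> K i))"
    using assms by (intro partition_function_Shearer) auto
  moreover have "(A \<union> B) \<inter> K i = K i" for i by (auto simp: K_def)
  ultimately show ?thesis by (simp add: UNIV_bool K_def mult.commute)
qed

definition overlay :: "'v set \<Rightarrow> ('v \<Rightarrow> nat) \<Rightarrow> ('v \<Rightarrow> nat) \<Rightarrow> 'v \<Rightarrow> nat" where
  "overlay A x y = (\<lambda>v\<in>V. if v \<in> A then x v else y v)"

lemma overlay_in_configs:
  assumes x: "x \<in> configs" and y: "y \<in> configs"
    and "\<And>u v. (u, v) \<in> E \<Longrightarrow> u \<in> A \<Longrightarrow> v \<notin> A \<Longrightarrow> x u = 0 \<or> y v = 0"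
  shows "overlay A x y \<in> configs"
proof -
  have EV: "u \<in> V" "v \<in> V" if "(u, v) \<in> E" for u v using that E_subset by auto
  have sym: "(v, u) \<in> E" if "(u, v) \<in> E" for u v using that sym_E by (auto dest: symD)
  have "overlay A x y \<in> V \<rightarrow>\<^sub>E {0, 1}"
    using x y by (auto simp: overlay_def configs_iff PiE_def Pi_def)
  moreover have "overlay A x y v \<noteq> 1" if uv: "(u, v) \<in> E" and 1: "overlay A x y u = 1" for u v
  proof -
    consider "u \<in> A" "v \<in> A" | "u \<in> A" "v \<notin> A" | "u \<notin> A" "v \<in> A" | "u \<notin> A" "v \<notin> A" by blast
    then show ?thesis
    proof cases
      case 1 then show ?thesis using uv x \<open>overlay A x y u = 1\<close> EV[OF uv] by (auto simp: overlay_def configs_iff)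
    next
      case 2 then show ?thesis using uv assms(3)[OF uv] \<open>overlay A x y u = 1\<close> EV[OF uv] by (auto simp: overlay_def)
    next
      case 3 then show ?thesis using assms(3)[OF sym[OF uv]] \<open>overlay A x y u = 1\<close> EV[OF uv] by (auto simp: overlay_def)
    next
      case 4 then show ?thesis using uv y \<open>overlay A x y u = 1\<close> EV[OF uv] by (auto simp: overlay_def configs_iff)
    qed
  qed
  ultimately show ?thesis by (auto simp: configs_iff)
qed

abbreviation empty_config :: "'v \<Rightarrow> nat" where "empty_config \<equiv> \<lambda>v\<in>V. 0"

lemma empty_config: "empty_config \<in> configs"
  using E_subset by (auto simp: configs_iff)

lemma weight_overlay:
  assumes "finite A" "finite B" "A \<inter> B = {}" "A \<subseteq> V" "B \<subseteq> V"
  shows "weight (A \<union> B) (overlay A x y) = weight A x * weight B y"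
proof -
  have "weight A (overlay A x y) = weight A x"
    unfolding weight_def overlay_def using assms by (intro prod.cong) auto
  moreover have "weight B (overlay A x y) = weight B y"
    unfolding weight_def overlay_def using assms by (intro prod.cong) auto
  ultimately show ?thesis using assms by (simp add: weight_def prod.union_disjoint)
qed

context
  fixes U D :: "'v set"
  assumes U: "finite U" "U \<subseteq> V" and D: "finite D" "D \<subseteq> V" and UD: "U \<inter> D = {}"
    and boundary: "E `` U \<subseteq> U \<union> D"
begin

text \<open>
Every edge leaving \<open>U\<close> ends in the collar \<open>D\<close>. Zeros there make any configuration on \<open>U\<close> compatible with any
boundary condition \<open>y\<close>.
\<close>

lemma fill_in_configs:
  assumes x: "x \<in> configs" and y: "y \<in> configs"
  shows "overlay U x (overlay D empty_config y) \<in> agreeing_off V E (U \<union> D) y"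
proof -
  have y': "overlay D empty_config y \<in> configs"
    by (rule overlay_in_configs[OF empty_config y]) (use D in auto)
  have "overlay U x (overlay D empty_config y) \<in> configs"
  proof (rule overlay_in_configs[OF x y'])
    fix u v assume "(u, v) \<in> E" "u \<in> U" "v \<notin> U"
    then have "v \<in> D" using boundary by auto
    then show "x u = 0 \<or> overlay D empty_config y v = 0" using D by (auto simp: overlay_def)
  qed
  then show ?thesis by (auto simp: agreeing_off_def overlay_def)
qed

lemma weight_fill: "weight (U \<union> D) (overlay U x (overlay D empty_config y)) = weight U x"
proof -
  have "weight D (overlay D empty_config y) = 1"
    unfolding weight_def overlay_def using D by (intro prod.neutral) auto
  then show ?thesis using U D UD by (simp add: weight_overlay)
qed

lemma restricted_partition_le:
  assumes y: "y \<in> configs"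
  shows "(\<Sum>z\<in>agreeing_off V E (U \<union> D) y. weight (U \<union> D) z) \<le> Z (U \<union> D)"
  unfolding partition_function_eq
proof (rule sum_le_included[where i = "\<lambda>z. overlay (U \<union> D) z y"])
  show "\<forall>z\<in>agreeing_off V E (U \<union> D) y. \<exists>z'\<in>agreeing_off V E (U \<union> D) (\<lambda>_. 0).
      overlay (U \<union> D) z' y = z \<and> weight (U \<union> D) z \<le> weight (U \<union> D) z'"
  proof
    fix z assume z: "z \<in> agreeing_off V E (U \<union> D) y"
    then have zc: "z \<in> configs" by (simp add: agreeing_off_def)
    let ?z = "overlay (U \<union> D) z empty_config"
    have "?z \<in> configs" by (rule overlay_in_configs[OF zc empty_config]) (use E_subset in auto)
    then have "?z \<in> agreeing_off V E (U \<union> D) (\<lambda>_. 0)" by (auto simp: agreeing_off_def overlay_def)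
    moreover have "overlay (U \<union> D) ?z y = z"
    proof
      fix v show "overlay (U \<union> D) ?z y v = z v"
        using z zc by (auto simp: overlay_def agreeing_off_def configs_iff PiE_def extensional_def)
    qed
    moreover have "weight (U \<union> D) ?z = weight (U \<union> D) z"
      using weight_overlay[of "U \<union> D" "{}" z] U D by (simp add: weight_def)
    ultimately show "\<exists>z'\<in>agreeing_off V E (U \<union> D) (\<lambda>_. 0).
      overlay (U \<union> D) z' y = z \<and> weight (U \<union> D) z \<le> weight (U \<union> D) z'" by force
  qed
qed (use U D finite_agreeing_off[of "U \<union> D" V E] weight_pos[of "U \<union> D"] in \<open>auto intro: less_imp_le\<close>)

lemma restricted_partition_ge:
  assumes y: "y \<in> configs"
  shows "Z U \<le> (\<Sum>z\<in>agreeing_off V E (U \<union> D) y. weight (U \<union> D) z)"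
  unfolding partition_function_eq
proof (rule sum_le_included[where i = "\<lambda>z. overlay U z empty_config"])
  show "\<forall>z\<in>agreeing_off V E U (\<lambda>_. 0). \<exists>z'\<in>agreeing_off V E (U \<union> D) y.
      overlay U z' empty_config = z \<and> weight U z \<le> weight (U \<union> D) z'"
  proof
    fix z assume z: "z \<in> agreeing_off V E U (\<lambda>_. 0)"
    then have zc: "z \<in> configs" by (simp add: agreeing_off_def)
    let ?z = "overlay U z (overlay D empty_config y)"
    have "overlay U ?z empty_config = z"
    proof
      fix v show "overlay U ?z empty_config v = z v"
        using z zc by (auto simp: overlay_def agreeing_off_def configs_iff PiE_def extensional_def)
    qed
    then show "\<exists>z'\<in>agreeing_off V E (U \<union> D) y.
      overlay U z' empty_config = z \<and> weight U z \<le> weight (U \<union> D) z'"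
      using fill_in_configs[OF zc y] weight_fill[where x = z and y = y] by force
  qed
qed (use U D finite_agreeing_off[of U V E] finite_agreeing_off[of "U \<union> D" V E] weight_pos[of "U \<union> D"]
    in \<open>auto intro: less_imp_le\<close>)

lemma sum_weight_cylinder_le:
  assumes x: "x \<in> configs" and y: "y \<in> configs"
  shows "(\<Sum>z\<in>agreeing_off V E (U \<union> D) y \<inter> cylinder V E U x. weight (U \<union> D) z) \<le> weight U x * Z D"
  unfolding partition_function_eq sum_distrib_left
proof (rule sum_le_included[where i = "\<lambda>z. overlay U x (overlay D z y)"])
  show "\<forall>z\<in>agreeing_off V E (U \<union> D) y \<inter> cylinder V E U x. \<exists>z'\<in>agreeing_off V E D (\<lambda>_. 0).
      overlay U x (overlay D z' y) = z \<and> weight (U \<union> D) z \<le> weight U x * weight D z'"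
  proof
    fix z assume z: "z \<in> agreeing_off V E (U \<union> D) y \<inter> cylinder V E U x"
    then have zc: "z \<in> configs" by (simp add: agreeing_off_def)
    let ?z = "overlay D z empty_config"
    have "?z \<in> configs" by (rule overlay_in_configs[OF zc empty_config]) (use E_subset in auto)
    then have "?z \<in> agreeing_off V E D (\<lambda>_. 0)" by (auto simp: agreeing_off_def overlay_def)
    moreover have eq: "overlay U x (overlay D ?z y) = z"
    proof
      fix v show "overlay U x (overlay D ?z y) v = z v"
        using z zc by (auto simp: overlay_def agreeing_off_def cylinder_def configs_iff PiE_def extensional_def)
    qed
    moreover have "weight (U \<union> D) z = weight U x * weight D ?z"
    proof -
      have "weight D (overlay D ?z y) = weight D ?z"
        unfolding weight_def overlay_def using D by (intro prod.cong) auto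
      then show ?thesis using weight_overlay[OF U(1) D(1) UD U(2) D(2), of x "overlay D ?z y"] eq by simp
    qed
    ultimately show "\<exists>z'\<in>agreeing_off V E D (\<lambda>_. 0).
      overlay U x (overlay D z' y) = z \<and> weight (U \<union> D) z \<le> weight U x * weight D z'" by force
  qed
qed (use U D finite_agreeing_off[of D V E] finite_agreeing_off[of "U \<union> D" V E]
    weight_pos[of U] weight_pos[of D] in \<open>auto intro!: mult_nonneg_nonneg less_imp_le\<close>)

text \<open>
The normalising sum for the boundary condition \<open>y\<close> lies between \<open>Z(U)\<close> and \<open>Z(U \<union> D)\<close>: it contains all configurations on
\<open>U\<close> extended by zeros on \<open>D\<close>, and it consists of some of the configurations on \<open>U \<union> D\<close>. The weight of
the cylinder is at least that of the extension of \<open>x\<close> by zeros on \<open>D\<close>, and at most \<open>Z(D)\<close> times the weight of \<open>x\<close>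
on \<open>U\<close>.
\<close>

lemma gibbs_spec_cylinder_bounds:
  assumes x: "x \<in> configs" and y: "y \<in> configs"
  shows "weight U x / (Z U * Z D) \<le> measure_pmf.prob (gibbs_spec V E lam (U \<union> D) y) (cylinder V E U x)"
    and "measure_pmf.prob (gibbs_spec V E lam (U \<union> D) y) (cylinder V E U x) \<le> weight U x * Z D / Z U"
proof -
  let ?W = "U \<union> D"
  let ?A = "agreeing_off V E ?W y"
  let ?p = "gibbs_spec V E lam ?W y"
  define Zy where "Zy = (\<Sum>z\<in>?A. weight ?W z)"
  have W: "?W \<subseteq> V" "finite ?W" using U D by auto
  have finA: "finite ?A" by (rule finite_agreeing_off[OF W(2)])
  have pmf: "pmf ?p z = (if z \<in> ?A then weight ?W z / Zy else 0)" for z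
    using pmf_gibbs_spec[where lam = lam and x = z, OF W lam_pos y] by (simp add: weight_def Zy_def)
  have ZU: "Z U \<ge> 1" and ZD: "Z D \<ge> 1" using U D partition_function_ge_1 by auto
  have Zy_ge: "Z U \<le> Zy" unfolding Zy_def by (rule restricted_partition_ge[OF y])
  have "Zy \<le> Z ?W" unfolding Zy_def by (rule restricted_partition_le[OF y])
  also have "\<dots> \<le> Z U * Z D" using partition_function_Un_le U D UD by blast
  finally have Zy_le: "Zy \<le> Z U * Z D" .
  have prob: "measure_pmf.prob ?p (cylinder V E U x) = (\<Sum>z\<in>?A \<inter> cylinder V E U x. weight ?W z) / Zy"
  proof -
    have "measure_pmf.prob ?p (cylinder V E U x) = measure_pmf.prob ?p (?A \<inter> cylinder V E U x)"
      by (rule measure_prob_cong_0) (auto simp: pmf)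
    also have "\<dots> = (\<Sum>z\<in>?A \<inter> cylinder V E U x. pmf ?p z)"
      using finA by (intro measure_measure_pmf_finite) auto
    also have "\<dots> = (\<Sum>z\<in>?A \<inter> cylinder V E U x. weight ?W z / Zy)"
      by (intro sum.cong) (auto simp: pmf)
    finally show ?thesis by (simp add: sum_divide_distrib)
  qed
  let ?z = "overlay U x (overlay D empty_config y)"
  have "?z \<in> ?A \<inter> cylinder V E U x"
    using fill_in_configs[OF x y] U by (auto simp: cylinder_def agreeing_off_def overlay_def)
  then have "weight ?W ?z \<le> (\<Sum>z\<in>?A \<inter> cylinder V E U x. weight ?W z)"
    using finA weight_pos[OF W(1)] by (intro member_le_sum) (auto intro: less_imp_le)
  then have ge: "weight U x \<le> (\<Sum>z\<in>?A \<inter> cylinder V E U x. weight ?W z)" by (simp add: weight_fill)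
  show "weight U x / (Z U * Z D) \<le> measure_pmf.prob ?p (cylinder V E U x)"
    unfolding prob using ge Zy_le Zy_ge ZU weight_pos[OF U(2), of x] by (intro frac_le) auto
  show "measure_pmf.prob ?p (cylinder V E U x) \<le> weight U x * Z D / Z U"
    unfolding prob using sum_weight_cylinder_le[OF x y] Zy_ge ZU ZD weight_pos[OF U(2), of x]
    by (intro frac_le) auto
qed

text \<open>
The bounds are uniform in the boundary condition, so they survive integration of the conditional
probabilities.
\<close>

lemma gibbs_cylinder_bounds:
  assumes P: "gibbs_measure V E lam P" and x: "x \<in> configs"
  shows "weight U x / (Z U * Z D) \<le> measure P (cylinder V E U x)"
    and "measure P (cylinder V E U x) \<le> weight U x * Z D / Z U"
proof -
  let ?W = "U \<union> D"
  let ?A = "cylinder V E U x"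
  \<comment> \<open>Conditioning outside \<open>U \<union> D\<close>, not outside \<open>U\<close>, leaves room for the zeros on \<open>D\<close>.\<close>
  let ?F = "coord_algebra V E (V - ?W)"
  let ?c = "real_cond_exp P ?F (indicator ?A)"
  have cP: "config_prob V E P" using P by (simp add: gibbs_measure_def)
  interpret P: prob_space P using cP by (simp add: config_prob_def)
  have sp: "space P = configs" by (rule config_prob_space[OF cP])
  have sub: "subalgebra P ?F" by (rule subalgebra_coord_algebra[OF cP]) auto
  interpret S: finite_measure_subalgebra P ?F by unfold_locales (rule sub)
  have A: "?A \<in> sets P" by (rule cylinder_in_sets[OF cP U])
  have int: "integrable P (indicat_real ?A)" using A by (simp add: P.emeasure_eq_measure)
  have mean: "measure P ?A = (\<integral>y. ?c y \<partial>P)"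
    using S.real_cond_exp_int(2)[OF int] A by simp
  have intc: "integrable P ?c" by (rule S.real_cond_exp_int(1)[OF int])
  have AE: "AE y in P. ?c y = measure_pmf.prob (gibbs_spec V E lam ?W y) ?A"
    by (rule P[unfolded gibbs_measure_def, THEN conjunct2, rule_format]) (use U D x in auto)
  have "AE y in P. weight U x / (Z U * Z D) \<le> ?c y"
    using AE AE_space by eventually_elim (use gibbs_spec_cylinder_bounds(1)[OF x] sp in auto)
  then have "(\<integral>y. weight U x / (Z U * Z D) \<partial>P) \<le> (\<integral>y. ?c y \<partial>P)"
    using intc by (intro integral_mono_AE) auto
  then show "weight U x / (Z U * Z D) \<le> measure P ?A" using mean by (simp add: P.prob_space)
  have "AE y in P. ?c y \<le> weight U x * Z D / Z U"
    using AE AE_space by eventually_elim (use gibbs_spec_cylinder_bounds(2)[OF x] sp in auto)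
  then have "(\<integral>y. ?c y \<partial>P) \<le> (\<integral>y. weight U x * Z D / Z U \<partial>P)"
    using intc by (intro integral_mono_AE) auto
  then show "measure P ?A \<le> weight U x * Z D / Z U" using mean by (simp add: P.prob_space)
qed

lemma ln_gibbs_cylinder:
  assumes P: "gibbs_measure V E lam P" and x: "x \<in> configs"
  shows "\<bar>ln (measure P (cylinder V E U x)) - ((\<Sum>v\<in>U. real (x v) * ln (lam v)) - ln (Z U))\<bar> \<le> ln (Z D)"
proof -
  have ZU: "Z U \<ge> 1" and ZD: "Z D \<ge> 1" using U D partition_function_ge_1 by auto
  have w: "weight U x > 0" by (rule weight_pos[OF U(2)])
  have lnw: "ln (weight U x) = (\<Sum>v\<in>U. real (x v) * ln (lam v))"
  proof -
    have pos: "lam v > 0" if "v \<in> U" for v using that U lam_pos by auto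
    then have "ln (weight U x) = (\<Sum>v\<in>U. ln (lam v ^ x v))"
      unfolding weight_def by (intro ln_prod) (use U in \<open>auto dest!: pos\<close>)
    also have "\<dots> = (\<Sum>v\<in>U. real (x v) * ln (lam v))"
      using pos by (intro sum.cong) (auto simp: ln_realpow)
    finally show ?thesis .
  qed
  have lo: "0 < weight U x / (Z U * Z D)" using w ZU ZD by simp
  then have p: "measure P (cylinder V E U x) > 0" using gibbs_cylinder_bounds(1)[OF P x] by linarith
  have "ln (weight U x / (Z U * Z D)) \<le> ln (measure P (cylinder V E U x))"
    using gibbs_cylinder_bounds(1)[OF P x] lo p by simp
  moreover have "ln (measure P (cylinder V E U x)) \<le> ln (weight U x * Z D / Z U)"
    using gibbs_cylinder_bounds(2)[OF P x] p w ZU ZD by simp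
  ultimately show ?thesis using w ZU ZD by (simp add: ln_div ln_mult lnw abs_le_iff)
qed

end
end

section \<open>Hardcore models with a free, almost transitive group action\<close>

sublocale hardcore_G \<subseteq> group G
  by (rule group_hom.axioms(1)[OF group_hom])

context hardcore_G
begin

lemma act_closed: "g \<in> carrier G \<Longrightarrow> v \<in> V \<Longrightarrow> act g v \<in> V"
  using element_image by blast

lemma act_inv: "g \<in> carrier G \<Longrightarrow> v \<in> V \<Longrightarrow> act (inv g) (act g v) = v"
  using orbit_sym_aux by blast

lemma partition_function_translate:
  assumes g: "g \<in> carrier G" and U: "finite U" "U \<subseteq> V"
  shows "Z (act g ` U) = Z U"
proof -
  have sw: "set_weight (act g ` S) = set_weight S" if S: "S \<subseteq> V" for S
  proof -
    have "independent (act g ` S) \<longleftrightarrow> independent S"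
      unfolding independent_def using automorphism[OF g] S by (simp add: subset_iff)
    moreover have "(\<Prod>v\<in>act g ` S. lam v) = (\<Prod>v\<in>S. lam v)"
    proof -
      have "inj_on (act g) S" using inj_prop[OF g] S by (rule inj_on_subset)
      then show ?thesis using lam_invariant[OF g] S by (simp add: prod.reindex subset_iff cong: prod.cong)
    qed
    ultimately show ?thesis by (simp add: set_weight_def)
  qed
  have "Pow (act g ` U) = (`) (act g) ` Pow U" by (rule image_Pow_surj[symmetric]) simp
  moreover have "inj_on ((`) (act g)) (Pow U)"
    using inj_on_subset[OF inj_prop[OF g] U(2)] by (rule inj_on_image_Pow)
  ultimately have "(\<Sum>S\<in>Pow (act g ` U). set_weight S) = (\<Sum>S\<in>Pow U. set_weight (act g ` S))"
    by (simp add: sum.reindex)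
  also have "\<dots> = (\<Sum>S\<in>Pow U. set_weight S)" using U sw by (intro sum.cong) auto
  finally show ?thesis
    using U act_closed[OF g] by (subst (1 2) partition_function_sets) auto
qed

lemma translates_eq: "translates act A U = (\<lambda>(g, v). act g v) ` (A \<times> U)"
  by (auto simp: translates_def)

lemma translates_subset: "A \<subseteq> carrier G \<Longrightarrow> U \<subseteq> V \<Longrightarrow> translates act A U \<subseteq> V"
  using act_closed by (auto simp: translates_def)

lemma act_translates:
  assumes "g \<in> carrier G" "A \<subseteq> carrier G" "U \<subseteq> V"
  shows "act g ` translates act A U = translates act ((\<otimes>) g ` A) U"
proof -
  have "act g ` translates act A U = (\<lambda>(h, v). act g (act h v)) ` (A \<times> U)"
    by (auto simp: translates_eq image_image case_prod_beta)
  also have "\<dots> = (\<lambda>(h, v). act (g \<otimes> h) v) ` (A \<times> U)"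
    using assms by (intro image_cong refl) (auto simp: composition_rule subset_iff)
  also have "\<dots> = translates act ((\<otimes>) g ` A) U"
    by (force simp: translates_eq)
  finally show ?thesis .
qed

context
  fixes U\<^sub>0 :: "'v set"
  assumes fd: "fundamental_domain G V act U\<^sub>0"
begin

lemma fd_subset: "U\<^sub>0 \<subseteq> V" using fd by (simp add: fundamental_domain_def)

lemma fd_unique: "v \<in> V \<Longrightarrow> \<exists>!u. u \<in> U\<^sub>0 \<and> u \<in> orbit G act v"
  using fd by (auto simp: fundamental_domain_def orbits_def)

lemma fd_representation:
  assumes v: "v \<in> V"
  obtains g u where "g \<in> carrier G" "u \<in> U\<^sub>0" "v = act g u"
proof -
  obtain u where u: "u \<in> U\<^sub>0" "u \<in> orbit G act v" using fd_unique[OF v] by blast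
  then obtain g where g: "g \<in> carrier G" "act g v = u" by (auto simp: orbit_def)
  then have "v = act (inv g) u" using act_inv v by auto
  then show ?thesis using that[of "inv g" u] g u by auto
qed

lemma fd_representation_unique:
  assumes g: "g \<in> carrier G" "h \<in> carrier G" and u: "u \<in> U\<^sub>0" "w \<in> U\<^sub>0" and eq: "act g u = act h w"
  shows "g = h \<and> u = w"
proof -
  have V: "u \<in> V" "w \<in> V" using u fd_subset by auto
  have w: "w = act (inv h \<otimes> g) u"
    using act_inv[OF g(2) V(2)] composition_rule[OF V(1), of "inv h" g] g eq by simp
  then have "w \<in> orbit G act u" using g by (auto simp: orbit_def)
  then have uw: "u = w" using fd_unique[OF V(1)] orbit_refl[OF V(1)] u by blast
  then have "inv h \<otimes> g \<in> stabilizer G act u" using w g by (auto simp: stabilizer_def)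
  then have "inv h \<otimes> g = \<one>" using free[OF V(1)] by simp
  then have "g = h" using g by (metis inv_closed inv_equality inv_inv)
  then show ?thesis using uw by simp
qed

lemma bij_betw_fd_orbits: "bij_betw (orbit G act) U\<^sub>0 (orbits G V act)"
  unfolding bij_betw_def
proof
  show "inj_on (orbit G act) U\<^sub>0"
  proof (rule inj_onI)
    fix u w assume u: "u \<in> U\<^sub>0" "w \<in> U\<^sub>0" and "orbit G act u = orbit G act w"
    then have "w \<in> orbit G act u" using orbit_refl fd_subset by auto
    then show "u = w" using u fd_unique[of u] orbit_refl[of u] fd_subset by blast
  qed
  show "orbit G act ` U\<^sub>0 = orbits G V act"
  proof
    show "orbit G act ` U\<^sub>0 \<subseteq> orbits G V act" using fd_subset by (auto simp: orbits_def)
    show "orbits G V act \<subseteq> orbit G act ` U\<^sub>0"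
    proof
      fix B assume B: "B \<in> orbits G V act"
      then obtain v where v: "v \<in> V" "B = orbit G act v" by (auto simp: orbits_def)
      then obtain u where u: "u \<in> U\<^sub>0" "u \<in> B" using fd_unique by blast
      then have "orbit G act u \<in> orbits G V act" "u \<in> orbit G act u" using fd_subset orbit_refl by (auto simp: orbits_def)
      then have "B = orbit G act u" using disjoint_union[OF B] u by blast
      then show "B \<in> orbit G act ` U\<^sub>0" using u by blast
    qed
  qed
qed

lemma finite_fd: "finite U\<^sub>0"
  using bij_betw_finite[OF bij_betw_fd_orbits] almost_transitive by simp

lemma card_fd: "card U\<^sub>0 = card (orbits G V act)"
  by (rule bij_betw_same_card[OF bij_betw_fd_orbits])

lemma inj_translates:
  assumes "A \<subseteq> carrier G"
  shows "inj_on (\<lambda>(g, v). act g v) (A \<times> U\<^sub>0)"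
proof (rule inj_onI)
  fix p q assume p: "p \<in> A \<times> U\<^sub>0" "q \<in> A \<times> U\<^sub>0" and eq: "(\<lambda>(g, v). act g v) p = (\<lambda>(g, v). act g v) q"
  obtain g u h w where "p = (g, u)" "q = (h, w)" by (cases p, cases q)
  then show "p = q" using fd_representation_unique[of g h u w] p eq assms by auto
qed

lemma translates_disjoint:
  assumes "A \<subseteq> carrier G" "B \<subseteq> carrier G" "A \<inter> B = {}"
  shows "translates act A U\<^sub>0 \<inter> translates act B U\<^sub>0 = {}"
proof (rule equals0I)
  fix v assume "v \<in> translates act A U\<^sub>0 \<inter> translates act B U\<^sub>0"
  then obtain g u h w where "g \<in> A" "u \<in> U\<^sub>0" "h \<in> B" "w \<in> U\<^sub>0" "act g u = act h w"
    unfolding translates_def by blast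
  then show False using fd_representation_unique[of g h u w] assms by blast
qed

lemma finite_translates: "finite A \<Longrightarrow> finite (translates act A U\<^sub>0)"
  by (simp add: translates_eq finite_fd)

lemma card_translates: "A \<subseteq> carrier G \<Longrightarrow> card (translates act A U\<^sub>0) = card A * card U\<^sub>0"
  by (simp add: translates_eq card_image inj_translates card_cartesian_product)

lemma sum_translates:
  "A \<subseteq> carrier G \<Longrightarrow> (\<Sum>v\<in>translates act A U\<^sub>0. h v) = (\<Sum>g\<in>A. \<Sum>u\<in>U\<^sub>0. h (act g u))"
  unfolding translates_eq sum.cartesian_product
  by (subst sum.reindex[OF inj_translates]) (auto intro!: sum.cong)

text \<open>
The translates \<open>g K U\<^sub>0\<close> that contain the vertex \<open>h u\<close>, where \<open>h \<in> A\<close> and \<open>u \<in> U\<^sub>0\<close>, are those with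
\<open>g \<in> h K\<^sup>-\<^sup>1\<close>; hence the translates by \<open>A K\<^sup>-\<^sup>1\<close> cover \<open>A U\<^sub>0\<close> exactly \<open>|K|\<close> times.
\<close>

lemma partition_function_cover:
  assumes A: "finite A" "A \<subseteq> carrier G" and K: "finite K" "K \<noteq> {}" "K \<subseteq> carrier G"
  shows "real (card K) * ln (Z (translates act A U\<^sub>0))
    \<le> real (card (A <#> set_inv K)) * ln (Z (translates act K U\<^sub>0))"
proof -
  let ?U = "translates act A U\<^sub>0" and ?T = "translates act K U\<^sub>0" and ?I = "A <#> set_inv K"
  have U: "finite ?U" "?U \<subseteq> V" and T: "finite ?T" "?T \<subseteq> V"
    using A K finite_translates translates_subset fd_subset by auto
  have I: "finite ?I" "?I \<subseteq> carrier G"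
    using A K by (auto simp: set_mult_def SET_INV_def)
  have "Z ?U ^ card K \<le> (\<Prod>g\<in>?I. Z (?U \<inter> act g ` ?T))"
  proof (rule partition_function_Shearer[OF U I(1)])
    show "card K > 0" using K by (simp add: card_gt_0_iff)
    fix v assume "v \<in> ?U"
    then obtain h u where h: "h \<in> A" "u \<in> U\<^sub>0" "v = act h u" by (auto simp: translates_def)
    then have hc: "h \<in> carrier G" using A by blast
    have "{g \<in> ?I. v \<in> act g ` ?T} = (\<lambda>k. h \<otimes> inv k) ` K"
    proof
      show "{g \<in> ?I. v \<in> act g ` ?T} \<subseteq> (\<lambda>k. h \<otimes> inv k) ` K"
      proof
        fix g assume "g \<in> {g \<in> ?I. v \<in> act g ` ?T}"
        then have g: "g \<in> carrier G" "v \<in> act g ` ?T" using I by auto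
        then have "v \<in> translates act ((\<otimes>) g ` K) U\<^sub>0" using act_translates K fd_subset by auto
        then obtain k w where k: "k \<in> K" "w \<in> U\<^sub>0" "v = act (g \<otimes> k) w" by (auto simp: translates_def)
        have kc: "k \<in> carrier G" using k K by blast
        then have "h = g \<otimes> k" using fd_representation_unique[of h "g \<otimes> k" u w] h k hc g by auto
        then have "g = h \<otimes> inv k" using g kc by (simp add: m_assoc)
        then show "g \<in> (\<lambda>k. h \<otimes> inv k) ` K" using k by blast
      qed
      show "(\<lambda>k. h \<otimes> inv k) ` K \<subseteq> {g \<in> ?I. v \<in> act g ` ?T}"
      proof
        fix g assume "g \<in> (\<lambda>k. h \<otimes> inv k) ` K"
        then obtain k where k: "k \<in> K" "g = h \<otimes> inv k" by blast
        have kc: "k \<in> carrier G" using k K by blast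
        have "act g (act k u) = v"
          using composition_rule[of u g k] h k kc hc fd_subset by (auto simp: m_assoc)
        moreover have "act k u \<in> ?T" using k h by (auto simp: translates_def)
        moreover have "g \<in> ?I" using k h by (auto simp: set_mult_def SET_INV_def)
        ultimately show "g \<in> {g \<in> ?I. v \<in> act g ` ?T}" by blast
      qed
    qed
    moreover have "inj_on (\<lambda>k. h \<otimes> inv k) K"
    proof (rule inj_onI)
      fix k l assume "k \<in> K" "l \<in> K" "h \<otimes> inv k = h \<otimes> inv l"
      then have "inv k = inv l" "k \<in> carrier G" "l \<in> carrier G" using K hc by (auto simp: subset_iff)
      then show "k = l" by (metis inv_inv)
    qed
    ultimately show "card {g \<in> ?I. v \<in> act g ` ?T} = card K" by (simp add: card_image)
  qed
  also have "\<dots> \<le> (\<Prod>g\<in>?I. Z ?T)"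
  proof (rule prod_mono)
    fix g assume g: "g \<in> ?I"
    then have gc: "g \<in> carrier G" using I by blast
    have "Z (?U \<inter> act g ` ?T) \<le> Z (act g ` ?T)"
      using T act_closed[OF gc] by (intro partition_function_mono) auto
    also have "\<dots> = Z ?T" by (rule partition_function_translate[OF gc T])
    finally have "Z (?U \<inter> act g ` ?T) \<le> Z ?T" .
    moreover have "Z (?U \<inter> act g ` ?T) \<ge> 1"
      using U by (intro partition_function_ge_1) auto
    ultimately show "0 \<le> Z (?U \<inter> act g ` ?T) \<and> Z (?U \<inter> act g ` ?T) \<le> Z ?T" by simp
  qed
  finally have le: "Z ?U ^ card K \<le> Z ?T ^ card ?I" by simp
  have pos: "Z ?U > 0" "Z ?T > 0"
    using partition_function_ge_1[OF U] partition_function_ge_1[OF T] by linarith+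
  then have "ln (Z ?U ^ card K) \<le> ln (Z ?T ^ card ?I)" using le by simp
  then show ?thesis using pos by (simp add: ln_realpow)
qed

text \<open>
For fixed \<open>K\<close>, the covering inequality for \<open>A = F\<^sub>n\<close> bounds the normalised logarithm for \<open>F\<^sub>n\<close> by the one for \<open>K\<close>
times \<open>|F\<^sub>n K\<^sup>-\<^sup>1| / |F\<^sub>n| \<longlonglongrightarrow> 1\<close>.
\<close>

lemma free_energy_limit:
  assumes F: "right_Folner G F"
  shows "(\<lambda>n. ln (Z (translates act (F n) U\<^sub>0)) / real (card (translates act (F n) U\<^sub>0)))
    \<longlonglongrightarrow> free_energy G V E lam act U\<^sub>0"
proof -
  define a where "a A = ln (Z (translates act A U\<^sub>0)) / real (card (translates act A U\<^sub>0))" for A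
  let ?S = "{A. A \<subseteq> carrier G \<and> finite A \<and> A \<noteq> {}}"
  have F': "F n \<in> ?S" for n using F by (auto simp: right_Folner_def)
  have a0: "a A \<ge> 0" if "A \<in> ?S" for A
    using that partition_function_ge_1[of "translates act A U\<^sub>0"] finite_translates translates_subset fd_subset
    by (auto simp: a_def intro!: divide_nonneg_nonneg)
  have bdd: "bdd_below (a ` ?S)" using a0 by (intro bdd_belowI[where m = 0]) auto
  have fe: "free_energy G V E lam act U\<^sub>0 = (INF A\<in>?S. a A)" by (simp add: free_energy_def a_def)
  have "(\<lambda>n. a (F n)) \<longlonglongrightarrow> (INF A\<in>?S. a A)"
  proof (rule order_tendstoI)
    fix y assume "y < (INF A\<in>?S. a A)"
    moreover have "(INF A\<in>?S. a A) \<le> a (F n)" for n using bdd F' by (intro cINF_lower) auto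
    ultimately have "y < a (F n)" for n by (rule less_le_trans)
    then show "\<forall>\<^sub>F n in sequentially. y < a (F n)" by simp
  next
    fix y assume "(INF A\<in>?S. a A) < y"
    moreover have "?S \<noteq> {}" using F'[of 0] by blast
    ultimately obtain K where K: "K \<in> ?S" "a K < y" using cINF_less_iff[of ?S a y] bdd by blast
    have inv: "finite (set_inv K)" "set_inv K \<subseteq> carrier G" using K by (auto simp: SET_INV_def)
    obtain r where r: "r \<longlonglongrightarrow> 1" "\<And>n. real (card (F n <#> set_inv K)) \<le> r n * real (card (F n))"
      using right_Folner_growth[OF F inv] by blast
    have le: "a (F n) \<le> r n * a K" for n
    proof -
      let ?x = "ln (Z (translates act (F n) U\<^sub>0))" and ?y = "ln (Z (translates act K U\<^sub>0))"
      have "1 \<le> Z (translates act K U\<^sub>0)"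
        using K finite_translates translates_subset fd_subset by (intro partition_function_ge_1) auto
      then have y: "?y \<ge> 0" by simp
      have pos: "card (F n) > 0" "card K > 0" using F'[of n] K by (auto simp: card_gt_0_iff)
      have "real (card K) * ?x \<le> real (card (F n <#> set_inv K)) * ?y"
        using F'[of n] K by (intro partition_function_cover) auto
      also have "\<dots> \<le> r n * real (card (F n)) * ?y" by (intro mult_right_mono r y)
      finally have "?x / real (card (F n)) \<le> r n * (?y / real (card K))"
        using pos by (simp add: field_simps)
      then have "?x / real (card (F n)) / real (card U\<^sub>0) \<le> r n * (?y / real (card K)) / real (card U\<^sub>0)"
        by (intro divide_right_mono) auto
      then show ?thesis using F'[of n] K by (simp add: a_def card_translates)
    qed
    have "(\<lambda>n. r n * a K) \<longlonglongrightarrow> 1 * a K" using r(1) by (intro tendsto_mult tendsto_const)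
    then have "\<forall>\<^sub>F n in sequentially. r n * a K < y" using K(2) by (intro order_tendstoD(2)) auto
    then show "\<forall>\<^sub>F n in sequentially. a (F n) < y"
      by eventually_elim (use le in \<open>auto intro: le_less_trans\<close>)
  qed
  then show ?thesis by (simp add: fe a_def)
qed

lemma partition_function_translates_le:
  assumes "finite A" "A \<subseteq> carrier G"
  shows "ln (Z (translates act A U\<^sub>0)) \<le> real (card A) * ln (Z U\<^sub>0)"
  using assms
proof (induction A rule: finite_induct)
  case empty
  then show ?case by (simp add: translates_def partition_function_empty)
next
  case (insert g A)
  let ?T = "translates act A U\<^sub>0"
  have g: "g \<in> carrier G" using insert.prems by blast
  have T: "finite ?T" "?T \<subseteq> V" using insert finite_translates translates_subset fd_subset by auto
  have gU: "finite (act g ` U\<^sub>0)" "act g ` U\<^sub>0 \<subseteq> V" using finite_fd fd_subset act_closed[OF g] by auto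
  have disj: "act g ` U\<^sub>0 \<inter> ?T = {}"
  proof -
    have "act g ` U\<^sub>0 = translates act {g} U\<^sub>0" by (auto simp: translates_def)
    then show ?thesis using translates_disjoint[of "{g}" A] insert.hyps insert.prems by simp
  qed
  have "translates act (insert g A) U\<^sub>0 = act g ` U\<^sub>0 \<union> ?T" by (auto simp: translates_def)
  then have "Z (translates act (insert g A) U\<^sub>0) \<le> Z U\<^sub>0 * Z ?T"
    using partition_function_Un_le[OF gU(1) T(1) gU(2) T(2) disj]
      partition_function_translate[OF g finite_fd fd_subset] by simp
  moreover have ge: "Z U\<^sub>0 \<ge> 1" "Z ?T \<ge> 1" "Z (translates act (insert g A) U\<^sub>0) \<ge> 1"
    using partition_function_ge_1[OF finite_fd fd_subset] partition_function_ge_1[OF T]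
      partition_function_ge_1[OF finite_translates translates_subset[OF insert.prems fd_subset]] insert.hyps
    by auto
  ultimately have "ln (Z (translates act (insert g A) U\<^sub>0)) \<le> ln (Z U\<^sub>0 * Z ?T)" by simp
  also have "\<dots> = ln (Z U\<^sub>0) + ln (Z ?T)" using ge by (simp add: ln_mult)
  also have "\<dots> \<le> ln (Z U\<^sub>0) + real (card A) * ln (Z U\<^sub>0)" using insert by simp
  finally show ?case using insert.hyps by (simp add: algebra_simps)
qed

text \<open>
The group elements that lead from the fundamental domain to a translate of it adjacent to it. With
\<open>K\<close> for this finite set, all neighbours of \<open>A U\<^sub>0\<close> lie in \<open>A K U\<^sub>0 \<union> A U\<^sub>0\<close>.
\<close>

definition connecting :: "'g set" where
  "connecting = {k \<in> carrier G. \<exists>u\<in>U\<^sub>0. \<exists>w\<in>U\<^sub>0. (u, act k w) \<in> E}"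

lemma finite_connecting: "finite connecting"
proof (rule finite_subset)
  let ?N = "E `` U\<^sub>0"
  have "finite ?N" 
  proof -
    have "finite (\<Union>u\<in>U\<^sub>0. E `` {u})"
      by (rule finite_UN_I[OF finite_fd]) (rule locally_finite[OF subsetD[OF fd_subset]])
    moreover have "?N = (\<Union>u\<in>U\<^sub>0. E `` {u})" by blast
    ultimately show ?thesis by argo
  qed
  let ?f = "\<lambda>(g, v). act g v"
  have "finite (?f -` ?N \<inter> (carrier G \<times> U\<^sub>0))"
    using \<open>finite ?N\<close> inj_translates[OF order_refl] by (rule finite_vimage_IntI)
  then show "finite (fst ` (?f -` ?N \<inter> (carrier G \<times> U\<^sub>0)))" by simp
  show "connecting \<subseteq> fst ` (?f -` ?N \<inter> (carrier G \<times> U\<^sub>0))"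
  proof
    fix k assume "k \<in> connecting"
    then obtain u w where "k \<in> carrier G" "u \<in> U\<^sub>0" "w \<in> U\<^sub>0" "(u, act k w) \<in> E"
      by (auto simp: connecting_def)
    then have "(k, w) \<in> ?f -` ?N \<inter> (carrier G \<times> U\<^sub>0)" by auto
    then show "k \<in> fst ` (?f -` ?N \<inter> (carrier G \<times> U\<^sub>0))" by (rule rev_image_eqI) simp
  qed
qed

lemma neighbours_translates:
  assumes A: "A \<subseteq> carrier G"
  shows "E `` translates act A U\<^sub>0 \<subseteq> translates act A U\<^sub>0 \<union> translates act ((A <#> connecting) - A) U\<^sub>0"
proof
  fix v assume "v \<in> E `` translates act A U\<^sub>0"
  then obtain f u where f: "f \<in> A" "u \<in> U\<^sub>0" and e: "(act f u, v) \<in> E" by (auto simp: translates_def)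
  have fc: "f \<in> carrier G" and uV: "u \<in> V" using f A fd_subset by auto
  have vV: "v \<in> V" using e E_subset by auto
  obtain h w where h: "h \<in> carrier G" "w \<in> U\<^sub>0" "v = act h w" using fd_representation[OF vV] .
  have wV: "w \<in> V" using h fd_subset by auto
  let ?k = "inv f \<otimes> h"
  have "act f (act ?k w) = v"
    using composition_rule[OF wV fc, of ?k] fc h by (simp add: m_assoc[symmetric])
  then have "(act f u, act f (act ?k w)) \<in> E" using e by simp
  then have "(u, act ?k w) \<in> E" using automorphism[OF fc uV, of "act ?k w"] act_closed[of ?k w] fc h wV by simp
  then have "?k \<in> connecting" using fc h f by (auto simp: connecting_def)
  moreover have "h = f \<otimes> ?k" using fc h by (simp add: m_assoc[symmetric])
  ultimately have "h \<in> A <#> connecting" using f unfolding set_mult_def by blast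
  then show "v \<in> translates act A U\<^sub>0 \<union> translates act ((A <#> connecting) - A) U\<^sub>0"
    using h by (auto simp: translates_def)
qed

lemma ln_gibbs_translates:
  assumes A: "finite A" "A \<subseteq> carrier G" and P: "gibbs_measure V E lam P" and x: "x \<in> configs"
  shows "\<bar>ln (measure P (cylinder V E (translates act A U\<^sub>0) x))
      - ((\<Sum>v\<in>translates act A U\<^sub>0. real (x v) * ln (lam v)) - ln (Z (translates act A U\<^sub>0)))\<bar>
    \<le> real (card ((A <#> connecting) - A)) * ln (Z U\<^sub>0)"
proof -
  let ?B = "(A <#> connecting) - A"
  have B: "finite ?B" "?B \<subseteq> carrier G"
    using A finite_connecting by (auto simp: set_mult_def connecting_def)
  have "translates act A U\<^sub>0 \<inter> translates act ?B U\<^sub>0 = {}"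
    using A B by (intro translates_disjoint) auto
  then have "\<bar>ln (measure P (cylinder V E (translates act A U\<^sub>0) x))
      - ((\<Sum>v\<in>translates act A U\<^sub>0. real (x v) * ln (lam v)) - ln (Z (translates act A U\<^sub>0)))\<bar>
    \<le> ln (Z (translates act ?B U\<^sub>0))"
    using A B finite_translates translates_subset fd_subset neighbours_translates P x
    by (intro ln_gibbs_cylinder) auto
  also have "\<dots> \<le> real (card ?B) * ln (Z U\<^sub>0)" by (rule partition_function_translates_le[OF B])
  finally show ?thesis .
qed

end

lemma shift_inv_apply: "g \<in> carrier G \<Longrightarrow> v \<in> V \<Longrightarrow> shift G V act (inv g) x v = x (act g v)"
  by (simp add: shift_def)

lemma shift_in_configs:
  assumes g: "g \<in> carrier G" and x: "x \<in> configs"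
  shows "shift G V act g x \<in> configs"
proof -
  have g': "inv g \<in> carrier G" using g by simp
  have EV: "u \<in> V \<and> v \<in> V" if "(u, v) \<in> E" for u v using that E_subset by auto
  have "shift G V act g x \<in> V \<rightarrow>\<^sub>E {0, 1}"
    using x act_closed[OF g'] by (auto simp: configs_iff shift_def PiE_def Pi_def)
  moreover have "shift G V act g x v \<noteq> 1" if uv: "(u, v) \<in> E" and 1: "shift G V act g x u = 1" for u v
  proof -
    have "u \<in> V" "v \<in> V" using EV[OF uv] by auto
    moreover from this have "(act (inv g) u, act (inv g) v) \<in> E" using automorphism[OF g'] uv by blast
    ultimately show ?thesis using x 1 by (auto simp: configs_iff shift_def)
  qed
  ultimately show ?thesis by (auto simp: configs_iff)
qed

lemma continuous_map_shift:
  assumes g: "g \<in> carrier G"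
  shows "continuous_map (config_topology V E) (config_topology V E) (shift G V act g)"
proof -
  let ?T = "product_topology (\<lambda>_. discrete_topology {0, 1 :: nat}) V"
  have g': "inv g \<in> carrier G" using g by simp
  have "continuous_map (config_topology V E) ?T (shift G V act g)"
    unfolding continuous_map_componentwise
  proof (intro conjI ballI)
    show "shift G V act g ` topspace (config_topology V E) \<subseteq> extensional V"
      by (auto simp: shift_def)
    fix v assume v: "v \<in> V"
    have "continuous_map ?T (discrete_topology {0, 1}) (\<lambda>x. x (act (inv g) v))"
      using act_closed[OF g' v] by (rule continuous_map_product_projection)
    then show "continuous_map (config_topology V E) (discrete_topology {0, 1}) (\<lambda>x. shift G V act g x v)"
      using v by (simp add: shift_def config_topology_def continuous_map_from_subtopology)
  qed
  moreover have "shift G V act g ` topspace (config_topology V E) \<subseteq> configs"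
    using shift_in_configs[OF g] by (auto simp: topspace_config_topology)
  ultimately show ?thesis
    by (subst (2) config_topology_def) (auto simp: continuous_map_in_subtopology)
qed

lemma measurable_shift:
  assumes Q: "config_prob V E Q" and g: "g \<in> carrier G"
  shows "shift G V act g \<in> Q \<rightarrow>\<^sub>M Q"
proof -
  have sp: "space Q = configs" by (rule config_prob_space[OF Q])
  have sQ: "sets Q = sigma_sets configs {U. openin (config_topology V E) U}"
    using Q by (simp add: config_prob_def sets_config_borel)
  show ?thesis
  proof (rule measurable_sigma_sets[OF sQ])
    show "{U. openin (config_topology V E) U} \<subseteq> Pow configs"
      using openin_subset[of "config_topology V E"] by (auto simp: topspace_config_topology)
    show "shift G V act g \<in> space Q \<rightarrow> configs" using shift_in_configs[OF g] sp by auto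
    fix B assume "B \<in> {U. openin (config_topology V E) U}"
    then have "openin (config_topology V E) {x \<in> topspace (config_topology V E). shift G V act g x \<in> B}"
      using openin_continuous_map_preimage[OF continuous_map_shift[OF g]] by auto
    moreover have "{x \<in> topspace (config_topology V E). shift G V act g x \<in> B} = shift G V act g -` B \<inter> space Q"
      by (auto simp: topspace_config_topology sp)
    ultimately show "shift G V act g -` B \<inter> space Q \<in> sets Q" unfolding sQ by (auto intro: sigma_sets.Basic)
  qed
qed

text \<open>
Passing to inverses turns the left action by shifts into a right action.
\<close>

lemma pmp_shift:
  assumes Q: "config_prob V E Q" and inv: "G_invariant G V act Q"
  shows "pmp_right_action G Q (\<lambda>g. shift G V act (inv g))"
proof -
  interpret Q: prob_space Q using Q by (simp add: config_prob_def)
  have sp: "space Q = configs" by (rule config_prob_space[OF Q])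
  show ?thesis
  proof
    fix g assume g: "g \<in> carrier G"
    then have g': "inv g \<in> carrier G" by simp
    show m: "shift G V act (inv g) \<in> Q \<rightarrow>\<^sub>M Q" by (rule measurable_shift[OF Q g'])
    show "distr Q Q (shift G V act (inv g)) = Q"
    proof (rule measure_eqI)
      fix A assume "A \<in> sets (distr Q Q (shift G V act (inv g)))"
      then have A: "A \<in> sets Q" by simp
      have "emeasure (distr Q Q (shift G V act (inv g))) A = emeasure Q (shift G V act (inv g) -` A \<inter> space Q)"
        by (rule emeasure_distr[OF m A])
      also have "\<dots> = emeasure Q A" using inv g' A by (simp add: G_invariant_def)
      finally show "emeasure (distr Q Q (shift G V act (inv g))) A = emeasure Q A" .
    qed simp
    fix h x assume h: "h \<in> carrier G"
    have "shift G V act (inv (g \<otimes> h)) x v = shift G V act (inv h) (shift G V act (inv g) x) v" for v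
    proof (cases "v \<in> V")
      case True
      then show ?thesis using g h act_closed[OF h True]
        by (simp add: shift_inv_apply composition_rule)
    qed (simp add: shift_def)
    then show "shift G V act (inv (g \<otimes> h)) x = shift G V act (inv h) (shift G V act (inv g) x)" ..
  qed
qed

lemma measurable_phi:
  assumes Q: "config_prob V E Q" and U: "U \<subseteq> V"
  shows "phi G V lam act U \<in> borel_measurable Q"
proof -
  have sp: "space Q = configs" by (rule config_prob_space[OF Q])
  have "(\<lambda>x. real (x v)) \<in> borel_measurable Q" if v: "v \<in> V" for v
  proof -
    have "(\<lambda>x. x v) \<in> Q \<rightarrow>\<^sub>M count_space UNIV"
    proof (rule measurableI)
      fix A :: "nat set"
      have "(\<lambda>x. x v) -` A \<inter> space Q = {x \<in> configs. x v \<in> A}" by (auto simp: sp)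
      also have "\<dots> \<in> sets Q"
        using Q coord_set_open[OF v, of E A] by (auto simp: config_prob_def sets_config_borel)
      finally show "(\<lambda>x. x v) -` A \<inter> space Q \<in> sets Q" .
    qed simp
    then show ?thesis by simp
  qed
  then show ?thesis unfolding phi_def[abs_def] using U
    by (intro borel_measurable_times borel_measurable_sum borel_measurable_const) auto
qed

lemma phi_bounded:
  assumes x: "x \<in> configs" and U: "U \<subseteq> V"
  shows "\<bar>phi G V lam act U x\<bar> \<le> 1 / real (card (orbits G V act)) * (\<Sum>v\<in>U. \<bar>ln (lam v)\<bar>)"
proof -
  have "\<bar>\<Sum>v\<in>U. real (x v) * ln (lam v)\<bar> \<le> (\<Sum>v\<in>U. \<bar>real (x v) * ln (lam v)\<bar>)" by (rule sum_abs)
  also have "\<dots> \<le> (\<Sum>v\<in>U. \<bar>ln (lam v)\<bar>)"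
    using U configs_values[OF x] by (intro sum_mono) (fastforce simp: abs_mult)
  finally show ?thesis unfolding phi_def abs_mult by (intro mult_mono) auto
qed

end

section \<open>Pointwise convergence of the information along tempered F\o lner sequences\<close>

theorem theorem7p1:
  fixes G :: "('g, 'm) monoid_scheme"
    and V :: "'v set" and E :: "('v \<times> 'v) set" and lam :: "'v \<Rightarrow> real"
    and act :: "'g \<Rightarrow> 'v \<Rightarrow> 'v" and U\<^sub>0 :: "'v set"
    and P Q :: "('v \<Rightarrow> nat) measure" and F :: "nat \<Rightarrow> 'g set"
  assumes "group G" and "countable (carrier G)" and "amenable G"
    and "hardcore_G G V E lam act"
    and "fundamental_domain G V act U\<^sub>0"
    and "gibbs_measure V E lam P"
    and "right_Folner G F" and "tempered G F"
    and "config_prob V E Q" and "G_invariant G V act Q" and "G_ergodic G V act Q"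
  shows "AE x in Q.
    (\<lambda>n. - (1 / real (card (translates act (F n) U\<^sub>0))
            * ln (measure P (cylinder V E (translates act (F n) U\<^sub>0) x))))
      \<longlonglongrightarrow> - (\<integral>x'. phi G V lam act U\<^sub>0 x' \<partial>Q) + free_energy G V E lam act U\<^sub>0"
proof -
  interpret hardcore_G G V E lam act by fact
  interpret Q: pmp_right_action G Q "\<lambda>g. shift G V act (inv\<^bsub>G\<^esub> g)"
    by (rule pmp_shift) fact+
  note fd = assms(5) and P = assms(6) and F = assms(7)
  have F': "F n \<subseteq> carrier G" "finite (F n)" "F n \<noteq> {}" for n using F by (auto simp: right_Folner_def)
  have sp: "space Q = indep_configs V E" by (rule config_prob_space) fact
  have erg: "Q.ergodic"
    unfolding Q.ergodic_def
  proof (intro ballI impI)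
    fix A assume A: "A \<in> sets Q"
      and inv: "\<forall>g\<in>carrier G. shift G V act (inv\<^bsub>G\<^esub> g) -` A \<inter> space Q = A"
    have "\<forall>g\<in>carrier G. shift G V act g -` A \<inter> space Q = A"
      using inv by (metis inv_closed inv_inv)
    then have "emeasure Q A = 0 \<or> emeasure Q A = 1"
      using A \<open>G_ergodic G V act Q\<close> by (simp add: G_ergodic_def)
    then show "measure Q A = 0 \<or> measure Q A = 1" by (auto simp: measure_def)
  qed
  let ?\<phi> = "phi G V lam act U\<^sub>0" and ?T = "\<lambda>n. translates act (F n) U\<^sub>0"
  let ?K = "connecting U\<^sub>0"
  have "AE x in Q. (\<lambda>n. Q.average (F n) ?\<phi> x) \<longlonglongrightarrow> (\<integral>x. ?\<phi> x \<partial>Q)"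
  proof (rule Q.pointwise_ergodic[OF _ erg F])
    show "?\<phi> \<in> borel_measurable Q" by (rule measurable_phi[OF assms(9) fd_subset[OF fd]])
    show "\<bar>?\<phi> x\<bar> \<le> 1 / real (card (orbits G V act)) * (\<Sum>v\<in>U\<^sub>0. \<bar>ln (lam v)\<bar>)"
      if "x \<in> space Q" for x
      using that sp by (intro phi_bounded fd_subset[OF fd]) simp
  qed fact+
  then show ?thesis using AE_space
  proof eventually_elim
    case (elim x)
    define c where "c n = real (card (?T n))" for n
    define p where "p n = ln (measure P (cylinder V E (?T n) x))" for n
    define s where "s n = (\<Sum>v\<in>?T n. real (x v) * ln (lam v))" for n
    define d where "d n = real (card ((F n <#>\<^bsub>G\<^esub> ?K) - F n))" for n
    have x: "x \<in> indep_configs V E" using elim(2) sp by simp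
    have c: "c n = real (card (F n)) * real (card U\<^sub>0)" for n
      using F' by (simp add: c_def card_translates[OF fd])
    have s: "s n / c n = Q.average (F n) ?\<phi> x" for n
    proof -
      have "s n = (\<Sum>g\<in>F n. \<Sum>u\<in>U\<^sub>0. real (x (act g u)) * ln (lam (act g u)))"
        unfolding s_def by (rule sum_translates[OF fd F'(1)])
      also have "\<dots> = (\<Sum>g\<in>F n. \<Sum>u\<in>U\<^sub>0. real (shift G V act (inv\<^bsub>G\<^esub> g) x u) * ln (lam u))"
      proof (intro sum.cong refl)
        fix g u assume "g \<in> F n" "u \<in> U\<^sub>0"
        then have "g \<in> carrier G" "u \<in> V" using F' fd_subset[OF fd] by auto
        then show "real (x (act g u)) * ln (lam (act g u)) = real (shift G V act (inv\<^bsub>G\<^esub> g) x u) * ln (lam u)"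
          by (simp add: shift_inv_apply lam_invariant)
      qed
      finally have "s n / c n = (\<Sum>g\<in>F n. \<Sum>u\<in>U\<^sub>0. real (shift G V act (inv\<^bsub>G\<^esub> g) x u) * ln (lam u)) / c n"
        by simp
      also have "\<dots> = Q.average (F n) ?\<phi> x"
        by (simp add: Q.average_def phi_def c card_fd[OF fd] sum_distrib_left[symmetric] sum_divide_distrib[symmetric] mult.commute)
      finally show ?thesis .
    qed
    \<comment> \<open>The boundary term is of order \<open>|F\<^sub>n K - F\<^sub>n| / |F\<^sub>n|\<close>, where \<open>K\<close> is the set of connecting elements.\<close>
    have err: "(\<lambda>n. p n / c n - (s n / c n - ln (partition_function V E lam (?T n)) / c n)) \<longlonglongrightarrow> 0"
    proof (rule Lim_null_comparison)
      have K: "finite ?K" "?K \<subseteq> carrier G" using finite_connecting[OF fd] by (auto simp: connecting_def[OF fd])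
      have "(\<lambda>n. d n / real (card (F n)) * (ln (partition_function V E lam U\<^sub>0) / real (card U\<^sub>0)))
          \<longlonglongrightarrow> 0 * (ln (partition_function V E lam U\<^sub>0) / real (card U\<^sub>0))"
        unfolding d_def by (intro tendsto_mult tendsto_const right_Folner_almost_invariant[OF F K])
      then show "(\<lambda>n. d n / real (card (F n)) * (ln (partition_function V E lam U\<^sub>0) / real (card U\<^sub>0)))
          \<longlonglongrightarrow> 0" by simp
      have "norm (p n / c n - (s n / c n - ln (partition_function V E lam (?T n)) / c n))
          \<le> d n / real (card (F n)) * (ln (partition_function V E lam U\<^sub>0) / real (card U\<^sub>0))" for n
      proof -
        have "p n / c n - (s n / c n - ln (partition_function V E lam (?T n)) / c n)
            = (p n - (s n - ln (partition_function V E lam (?T n)))) / c n"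
          by (simp add: diff_divide_distrib)
        also have "norm \<dots> = \<bar>p n - (s n - ln (partition_function V E lam (?T n)))\<bar> / c n"
          by (simp add: c_def)
        also have "\<dots> \<le> d n * ln (partition_function V E lam U\<^sub>0) / c n"
          unfolding p_def s_def d_def
          by (rule divide_right_mono[OF ln_gibbs_translates[OF fd F'(2) F'(1) P x]]) (simp add: c_def)
        finally show ?thesis by (simp add: c)
      qed
      then show "\<forall>\<^sub>F n in sequentially. norm (p n / c n - (s n / c n - ln (partition_function V E lam (?T n)) / c n))
          \<le> d n / real (card (F n)) * (ln (partition_function V E lam U\<^sub>0) / real (card U\<^sub>0))" by simp
    qed
    have "(\<lambda>n. - s n / c n + ln (partition_function V E lam (?T n)) / c n
          - (p n / c n - (s n / c n - ln (partition_function V E lam (?T n)) / c n)))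
        \<longlonglongrightarrow> - (\<integral>x'. ?\<phi> x' \<partial>Q) + free_energy G V E lam act U\<^sub>0 - 0"
    proof (intro tendsto_diff tendsto_add err)
      show "(\<lambda>n. - s n / c n) \<longlonglongrightarrow> - (\<integral>x'. ?\<phi> x' \<partial>Q)"
        using tendsto_minus[OF elim(1)] by (simp add: s)
      show "(\<lambda>n. ln (partition_function V E lam (?T n)) / c n) \<longlonglongrightarrow> free_energy G V E lam act U\<^sub>0"
        unfolding c_def by (rule free_energy_limit[OF fd F])
    qed
    then show ?case by (simp add: p_def c_def)
  qed
qed

end
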